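(* For all $k\ge 3$, the cut complex $\Delta_k(P_{k+3}^2)$ is homotopy equivalent to a wedge of $\binom{k-1}{2}$ two-dimensional spheres $\mathbb{S}^2$, and it has $k^2-1$ facets.
   Context: The squared path $P^2_n$ is the graph on vertex set $\{1,\dots,n\}$ with edges $\{i,i+1\}$ for $1\le i\le n-1$ and $\{i,i+2\}$ for $1\le i\le n-2$. For a graph $G=(V,E)$ with $|V|=N$ and $k\ge 2$, the $k$-cut complex $\Delta_k(G)$ is the simplicial complex on $V$ whose facets are the subsets $F\subseteq V$ with $|F|=N-k$ such that the induced subgraph $G[V\setminus F]$ is disconnected. *)

theory Defs
  imports "HOL-Analysis.Analysis" "Graph_Theory.Graph_Theory"
begin

text \<open>Undirected graphs are loop-free symmetric digraphs (locale \<^locale>\<open>pair_graph\<close>): an edge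
  \<open>{u, v}\<close> is the pair of arcs \<open>(u, v)\<close>, \<open>(v, u)\<close>.\<close>

definition squared_path_edges :: "nat \<Rightarrow> nat set set" where
  "squared_path_edges n =
     {{i, i + 1} | i. 1 \<le> i \<and> i + 1 \<le> n} \<union> {{i, i + 2} | i. 1 \<le> i \<and> i + 2 \<le> n}"

definition squared_path :: "nat \<Rightarrow> nat pair_pre_digraph" where
  "squared_path n = \<lparr> pverts = {1..n}, parcs = {(u, v). {u, v} \<in> squared_path_edges n} \<rparr>"

lemma pair_graph_squared_path: "pair_graph (squared_path n)"
proof -
  have "{(u, v). {u, v} \<in> squared_path_edges n} \<subseteq> {1..n} \<times> {1..n}"
    by (auto simp: squared_path_edges_def doubleton_eq_iff)
  then have "finite {(u, v). {u, v} \<in> squared_path_edges n}"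
    by (rule finite_subset) simp
  then show ?thesis
    by unfold_locales
      (auto simp: squared_path_def squared_path_edges_def doubleton_eq_iff symmetric_def sym_def)
qed

text \<open>A simplicial complex is given by its set of faces. The cut complex of a graph is generated
  by its prescribed facets; \<open>card F + k = card V\<close> expresses \<open>card F = card V - k\<close> without
  truncation.\<close>

definition cut_facets :: "nat \<Rightarrow> 'a pair_pre_digraph \<Rightarrow> 'a set set" where
  "cut_facets k G =
     {F. F \<subseteq> pverts G \<and> card F + k = card (pverts G) \<and>
         \<not> Digraph_Component.connected (with_proj G \<restriction> (pverts G - F))}"

definition cut_complex :: "nat \<Rightarrow> 'a pair_pre_digraph \<Rightarrow> 'a set set" where
  "cut_complex k G = {S. \<exists>F\<in>cut_facets k G. S \<subseteq> F}"

definition facets :: "'a set set \<Rightarrow> 'a set set" where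
  "facets K = {F \<in> K. \<forall>S\<in>K. F \<subseteq> S \<longrightarrow> S = F}"

lemma facets_cut_complex:
  assumes "finite (pverts G)"
  shows "facets (cut_complex k G) = cut_facets k G"
proof -
  have eq: "F = F'" if "F \<in> cut_facets k G" "F' \<in> cut_facets k G" "F \<subseteq> F'" for F F'
  proof -
    have "finite F'" "card F = card F'"
      using that assms by (auto simp: cut_facets_def intro: finite_subset)
    then show ?thesis
      using that(3) by (simp add: card_subset_eq)
  qed
  show ?thesis
  proof (intro equalityI subsetI)
    fix F assume "F \<in> facets (cut_complex k G)"
    then show "F \<in> cut_facets k G"
      unfolding facets_def cut_complex_def by blast
  next
    fix F assume F: "F \<in> cut_facets k G"
    have "S = F" if S: "S \<in> cut_complex k G" "F \<subseteq> S" for S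
    proof -
      obtain F' where "F' \<in> cut_facets k G" "S \<subseteq> F'"
        using S(1) unfolding cut_complex_def by blast
      then show ?thesis
        using eq[OF F, of F'] S(2) by blast
    qed
    then show "F \<in> facets (cut_complex k G)"
      using F unfolding facets_def cut_complex_def by blast
  qed
qed

text \<open>Points are given by their barycentric coordinates: the standard realization inside the real
  vector space on the vertices. The product topology is the usual one for a complex with finitely
  many vertices, which is the only case used here.\<close>

definition geometric_realization :: "'a set set \<Rightarrow> ('a \<Rightarrow> real) topology" where
  "geometric_realization K =
     subtopology (powertop_real UNIV)
       {x. (\<forall>v. 0 \<le> x v) \<and> {v. x v \<noteq> 0} \<in> K \<and> (\<Sum>v\<in>{v. x v \<noteq> 0}. x v) = 1}"

text \<open>The wedge of the pointed spaces \<open>(X i, p i)\<close>: the quotient of their disjoint union in which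
  all base points become the single point \<^const>\<open>None\<close>. The point \<^const>\<open>None\<close> is present even for
  an empty family, so that the empty wedge is a point.\<close>

fun wedge_collapse :: "('i \<Rightarrow> 'a) \<Rightarrow> 'i \<times> 'a \<Rightarrow> ('i \<times> 'a) option" where
  "wedge_collapse p (i, x) = (if x = p i then None else Some (i, x))"

definition wedge_topology ::
  "('i \<Rightarrow> 'a topology) \<Rightarrow> ('i \<Rightarrow> 'a) \<Rightarrow> 'i set \<Rightarrow> ('i \<times> 'a) option topology" where
  "wedge_topology X p I =
     topology (\<lambda>U. U \<subseteq> insert None (wedge_collapse p ` topspace (sum_topology X I)) \<and>
       openin (sum_topology X I) {z \<in> topspace (sum_topology X I). wedge_collapse p z \<in> U})"

lemma openin_wedge_topology:
  "openin (wedge_topology X p I) U \<longleftrightarrow>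
     U \<subseteq> insert None (wedge_collapse p ` topspace (sum_topology X I)) \<and>
     openin (sum_topology X I) {z \<in> topspace (sum_topology X I). wedge_collapse p z \<in> U}"
proof -
  let ?S = "sum_topology X I" and ?q = "wedge_collapse p"
  have int: "{z \<in> topspace ?S. ?q z \<in> U \<inter> V} =
      {z \<in> topspace ?S. ?q z \<in> U} \<inter> {z \<in> topspace ?S. ?q z \<in> V}" for U V
    by blast
  have un: "{z \<in> topspace ?S. ?q z \<in> \<Union>\<K>} = (\<Union>U\<in>\<K>. {z \<in> topspace ?S. ?q z \<in> U})" for \<K>
    by blast
  have "istopology (\<lambda>U. U \<subseteq> insert None (?q ` topspace ?S) \<and>
      openin ?S {z \<in> topspace ?S. ?q z \<in> U})"
    unfolding istopology_def
  proof (intro conjI allI impI)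
    fix \<K> assume "\<forall>U\<in>\<K>. U \<subseteq> insert None (?q ` topspace ?S) \<and>
      openin ?S {z \<in> topspace ?S. ?q z \<in> U}"
    then show "\<Union>\<K> \<subseteq> insert None (?q ` topspace ?S)"
      and "openin ?S {z \<in> topspace ?S. ?q z \<in> \<Union>\<K>}"
      unfolding un by blast+
  qed (unfold int, auto)
  then show ?thesis
    by (simp add: wedge_topology_def)
qed

lemma topspace_wedge_topology:
  "topspace (wedge_topology X p I) = insert None (wedge_collapse p ` topspace (sum_topology X I))"
    (is "_ = ?T")
proof -
  let ?S = "sum_topology X I"
  have "{z \<in> topspace ?S. wedge_collapse p z \<in> ?T} = topspace ?S"
    by blast
  then have "openin (wedge_topology X p I) ?T"
    unfolding openin_wedge_topology by (simp only: openin_topspace subset_refl simp_thms)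
  then have "?T \<subseteq> topspace (wedge_topology X p I)"
    by (rule openin_subset)
  moreover have "topspace (wedge_topology X p I) \<subseteq> ?T"
    using openin_topspace[of "wedge_topology X p I"] unfolding openin_wedge_topology by blast
  ultimately show ?thesis
    by blast
qed

lemma quotient_map_wedge_collapse:
  assumes "I \<noteq> {}" and p: "\<And>i. i \<in> I \<Longrightarrow> p i \<in> topspace (X i)"
  shows "quotient_map (sum_topology X I) (wedge_topology X p I) (wedge_collapse p)"
proof -
  obtain i where "i \<in> I"
    using assms(1) by blast
  then have "(i, p i) \<in> topspace (sum_topology X I)"
    using p by (simp add: topspace_sum_topology)
  then have "wedge_collapse p (i, p i) \<in> wedge_collapse p ` topspace (sum_topology X I)"
    by (rule imageI)
  then have "None \<in> wedge_collapse p ` topspace (sum_topology X I)"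
    by simp
  then show ?thesis
    by (auto simp: quotient_map_def topspace_wedge_topology openin_wedge_topology insert_absorb)
qed

definition nsphere_basepoint :: "nat \<Rightarrow> real" where
  "nsphere_basepoint i = (if i = 0 then 1 else 0)"

lemma nsphere_basepoint: "nsphere_basepoint \<in> topspace (nsphere d)"
  by (simp add: nsphere nsphere_basepoint_def if_distrib[of "\<lambda>x. x ^ 2"] cong: if_cong)

definition wedge_of_spheres :: "nat \<Rightarrow> nat \<Rightarrow> (nat \<times> (nat \<Rightarrow> real)) option topology" where
  "wedge_of_spheres d m = wedge_topology (\<lambda>_. nsphere d) (\<lambda>_. nsphere_basepoint) {..<m}"

end

theory Submission
  imports Defs
begin

text \<open>Write \<open>n = k + 3\<close>. Deleting a triple disconnects \<open>P\<^sup>2\<^sub>n\<close> iff the triple contains two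
  consecutive vertices with survivors on both sides. Hence the facets are the triples
  \<open>{i, i + 1, j}\<close> with \<open>2 \<le> i \<le> n - 2\<close>, except \<open>{1, 2, 3}\<close> and \<open>{n - 2, n - 1, n}\<close>.

  The links of the vertices \<open>1\<close> and \<open>n\<close> are paths, so both vertices can be removed without changing
  the homotopy type. In the remaining complex the triples \<open>{a, b, b + 1}\<close> with \<open>a < b\<close> generate a
  collapsible subcomplex \<open>A\<close> (the largest vertex is always dominated by its predecessor) that
  contains all edges. The other \<open>(k - 1) choose 2\<close> triangles \<open>{a, a + 1, b}\<close>, \<open>b \<ge> a + 3\<close>, are
  attached to \<open>A\<close> along their boundaries and become the spheres. To see this, attach a cone over
  \<open>A\<close>, which changes nothing because \<open>A\<close> is collapsible, and then collapse the cone to a point; here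
  the homotopy that contracts the cone extends to the triangles by an explicit formula.\<close>

section \<open>Collapses\<close>

lemma homotopic_with_TrueI:
  fixes h :: "real \<times> 'a \<Rightarrow> 'b"
  assumes "continuous_map (prod_topology (top_of_set {0..1}) X) Y h"
    and "\<And>x. x \<in> topspace X \<Longrightarrow> h (0, x) = f x" "\<And>x. x \<in> topspace X \<Longrightarrow> h (1, x) = g x"
  shows "homotopic_with (\<lambda>_. True) X Y f g"
proof -
  have "\<exists>h. continuous_map (prod_topology (top_of_set {0..1::real}) X) Y h \<and>
      (\<forall>x\<in>topspace X. h (0, x) = f x) \<and> (\<forall>x\<in>topspace X. h (1, x) = g x) \<and> (\<forall>t\<in>{0..1::real}. True)"
    using assms by (intro exI[of _ h]) simp
  then show ?thesis by (simp add: homotopic_with)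
qed

text \<open>Coordinates outside the support contribute nothing, so the varying support can be
  replaced by the fixed finite set \<open>V\<close>; the normalisation becomes a linear
  condition.\<close>

lemma topspace_geometric_realization:
  assumes "finite V" "K \<subseteq> Pow V"
  shows "topspace (geometric_realization K) =
    {x. (\<forall>v. 0 \<le> x v) \<and> {v. x v \<noteq> 0} \<in> K \<and> sum x V = 1}"
proof -
  have "sum x {v. x v \<noteq> 0} = sum x V" if "{v. x v \<noteq> 0} \<in> K" for x :: "'a \<Rightarrow> real"
    using assms that by (intro sum.mono_neutral_left) auto
  then show ?thesis
    by (auto simp: geometric_realization_def)
qed

text \<open>The product topology is the \<open>euclidean\<close> topology of the function type, so
  continuity between realizations becomes \<open>continuous_on\<close> for explicit
  formulas.\<close>

lemma geometric_realization_top_of_set: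
  obtains X where "geometric_realization K = top_of_set X"
  unfolding geometric_realization_def euclidean_product_topology by blast

lemma continuous_map_geometric_realization:
  "continuous_map (geometric_realization K) (geometric_realization L) f \<longleftrightarrow>
    continuous_on (topspace (geometric_realization K)) f \<and>
    f ` topspace (geometric_realization K) \<subseteq> topspace (geometric_realization L)"
proof -
  obtain X where "geometric_realization K = top_of_set X"
    by (rule geometric_realization_top_of_set)
  moreover obtain Y where "geometric_realization L = top_of_set Y"
    by (rule geometric_realization_top_of_set)
  ultimately show ?thesis by (auto simp: continuous_map_in_subtopology)
qed

lemma homotopic_with_geometric_realization:
  fixes K :: "'a set set" and L :: "'b set set" and h :: "real \<times> ('a \<Rightarrow> real) \<Rightarrow> 'b \<Rightarrow> real"
  assumes h: "continuous_on ({0..1} \<times> topspace (geometric_realization K)) h"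
    and into: "\<And>t x. \<lbrakk>t \<in> {0..1}; x \<in> topspace (geometric_realization K)\<rbrakk>
      \<Longrightarrow> h (t, x) \<in> topspace (geometric_realization L)"
    and f: "\<And>x. x \<in> topspace (geometric_realization K) \<Longrightarrow> h (0, x) = f x"
    and g: "\<And>x. x \<in> topspace (geometric_realization K) \<Longrightarrow> h (1, x) = g x"
  shows "homotopic_with (\<lambda>_. True) (geometric_realization K) (geometric_realization L) f g"
proof -
  obtain X where X: "geometric_realization K = top_of_set X"
    by (rule geometric_realization_top_of_set)
  obtain Y where Y: "geometric_realization L = top_of_set Y"
    by (rule geometric_realization_top_of_set)
  have "continuous_map (prod_topology (top_of_set {0..1}) (geometric_realization K))
      (geometric_realization L) h"
    using h into by (auto simp: X Y continuous_map_in_subtopology)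
  then show ?thesis
    using f g by (rule homotopic_with_TrueI)
qed

lemma continuous_on_Min_image:
  fixes f :: "'i \<Rightarrow> 'a::topological_space \<Rightarrow> 'b::linorder_topology"
  assumes "finite I" "I \<noteq> {}" "\<And>i. i \<in> I \<Longrightarrow> continuous_on S (f i)"
  shows "continuous_on S (\<lambda>x. Min ((\<lambda>i. f i x) ` I))"
  using assms
proof (induction I rule: finite_ne_induct)
  case (insert i I)
  then have "continuous_on S (\<lambda>x. min (f i x) (Min ((\<lambda>i. f i x) ` I)))"
    by (intro continuous_on_min) auto
  with insert show ?case by simp
qed simp

definition down_closed :: "'a set set \<Rightarrow> bool" where
  "down_closed K \<longleftrightarrow> (\<forall>S\<in>K. \<forall>T. T \<subseteq> S \<longrightarrow> T \<in> K)"

lemma down_closedD: "down_closed K \<Longrightarrow> S \<in> K \<Longrightarrow> T \<subseteq> S \<Longrightarrow> T \<in> K"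
  by (auto simp: down_closed_def)

text \<open>If every face containing \<open>\<sigma>\<close> spans a face together with \<open>v\<close>, then the amount
  \<open>min x\<^sub>u\<close> (\<open>u \<in> \<sigma>\<close>) can be moved linearly from all the vertices of \<open>\<sigma>\<close> to \<open>v\<close>.\<close>

lemma collapse_homotopy_equivalent:
  fixes K :: "'a set set"
  assumes V: "finite V" "K \<subseteq> Pow V" and K: "down_closed K"
    and \<sigma>: "\<sigma> \<noteq> {}" "finite \<sigma>" "v \<notin> \<sigma>"
    and dom: "\<And>S. \<lbrakk>S \<in> K; \<sigma> \<subseteq> S\<rbrakk> \<Longrightarrow> insert v S \<in> K"
  shows "geometric_realization K homotopy_equivalent_space
    geometric_realization {S \<in> K. \<not> \<sigma> \<subseteq> S}"
proof -
  define L where "L = {S \<in> K. \<not> \<sigma> \<subseteq> S}"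
  \<comment> \<open>\<open>v\<close> and \<open>\<sigma>\<close> are not assumed to lie in
    \<open>V\<close>; sums over \<open>U\<close> see every coordinate that the homotopy
    changes.\<close>
  define U where "U = insert v (V \<union> \<sigma>)"
  have U: "finite U" "K \<subseteq> Pow U" "L \<subseteq> Pow U" "\<sigma> \<subseteq> U" "v \<in> U"
    using V \<sigma> by (auto simp: U_def L_def)
  define m :: "('a \<Rightarrow> real) \<Rightarrow> real" where "m x = Min (x ` \<sigma>)" for x
  \<comment> \<open>The direction of motion: each vertex of \<open>\<sigma>\<close> loses one unit
    and \<open>v\<close> gains \<open>card \<sigma>\<close> units, so the sum is preserved.\<close>
  define d :: "'a \<Rightarrow> real" where
    "d u = (if u = v then of_nat (card \<sigma>) else 0) - (if u \<in> \<sigma> then 1 else 0)" for u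
  define h where "h p = (\<lambda>u. snd p u + fst p * m (snd p) * d u)" for p
  have sum_d: "sum d U = 0"
    using U \<sigma> by (simp add: d_def sum_subtractf sum.If_cases Int_absorb1 Int_absorb2)
  have m_le: "m x \<le> x u" if "u \<in> \<sigma>" for x u
    using that \<sigma> by (auto simp: m_def)
  have m_eq: "\<exists>u\<in>\<sigma>. m x = x u" for x
    using Min_in[of "x ` \<sigma>"] \<sigma> by (metis finite_imageI image_is_empty imageE m_def)
  have cont: "continuous_on X h" for X
    unfolding h_def m_def using \<sigma>
    by (intro continuous_intros continuous_on_Min_image continuous_on_product_then_coordinatewise) auto
  have tK: "topspace (geometric_realization K) =
      {x. (\<forall>v. 0 \<le> x v) \<and> {v. x v \<noteq> 0} \<in> K \<and> sum x U = 1}"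
    and tL: "topspace (geometric_realization L) =
      {x. (\<forall>v. 0 \<le> x v) \<and> {v. x v \<noteq> 0} \<in> L \<and> sum x U = 1}"
    using U by (auto simp: topspace_geometric_realization)
  have into: "h (t, x) \<in> topspace (geometric_realization K) \<and>
      (t = 1 \<longrightarrow> h (t, x) \<in> topspace (geometric_realization L))"
    if t: "t \<in> {0..1}" and x: "x \<in> topspace (geometric_realization K)" for t x
  proof -
    have x0: "0 \<le> x u" for u using x by (auto simp: tK)
    have m0: "0 \<le> m x" using m_eq[of x] x0 by auto
    have nn: "0 \<le> h (t, x) u" for u
    proof -
      have "t * m x \<le> 1 * m x" using t m0 by (intro mult_right_mono) auto
      then have "t * m x \<le> x u" if "u \<in> \<sigma>" using m_le[OF that, of x] by simp
      then show ?thesis using x0[of u] t m0 \<sigma> by (auto simp: h_def d_def)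
    qed
    have sm: "sum (h (t, x)) U = 1"
      using x sum_d by (simp add: h_def sum.distrib tK flip: sum_distrib_left)
    have supp: "{u. h (t, x) u \<noteq> 0} \<in> K \<and> (t = 1 \<longrightarrow> {u. h (t, x) u \<noteq> 0} \<in> L)"
    proof (cases "m x = 0")
      case True
      then have hx: "h (t, x) = x" by (simp add: h_def)
      obtain u where "u \<in> \<sigma>" "x u = 0" using m_eq[of x] True by auto
      then have "\<not> \<sigma> \<subseteq> {u. x u \<noteq> 0}" by auto
      then show ?thesis using x unfolding hx by (simp add: tK L_def)
    next
      case False
      have "x u \<noteq> 0" if "u \<in> \<sigma>" for u using m_le[OF that, of x] m0 False by auto
      then have "insert v {u. x u \<noteq> 0} \<in> K" using x by (intro dom) (auto simp: tK)
      moreover have sub: "{u. h (t, x) u \<noteq> 0} \<subseteq> insert v {u. x u \<noteq> 0}"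
        using \<open>\<And>u. u \<in> \<sigma> \<Longrightarrow> x u \<noteq> 0\<close> by (auto simp: h_def d_def split: if_splits)
      ultimately have *: "{u. h (t, x) u \<noteq> 0} \<in> K" using K down_closedD by blast
      \<comment> \<open>A vertex attaining the minimum is emptied at time 1, so the support no
        longer contains \<open>\<sigma>\<close>.\<close>
      obtain u where u: "u \<in> \<sigma>" "m x = x u" using m_eq by blast
      then have "h (1, x) u = 0" using \<sigma> by (auto simp: h_def d_def)
      with u have "\<not> \<sigma> \<subseteq> {u. h (1, x) u \<noteq> 0}" by auto
      with * show ?thesis by (auto simp: L_def)
    qed
    show ?thesis using nn sm supp by (auto simp: tK tL)
  qed
  have r: "retraction_maps (geometric_realization K) (geometric_realization L) (\<lambda>x. h (1, x)) id"
  proof -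
    have "continuous_on X (\<lambda>x. h (1, x))" for X
      by (rule continuous_on_compose2[OF cont[of UNIV]]) (auto intro: continuous_intros)
    moreover have "h (1, x) = x" if "x \<in> topspace (geometric_realization L)" for x
    proof -
      have "\<not> \<sigma> \<subseteq> {u. x u \<noteq> 0}" using that unfolding tL by (simp add: L_def)
      then obtain u where "u \<in> \<sigma>" "x u = 0" by blast
      moreover have "0 \<le> m x" using m_eq[of x] that by (auto simp: tL)
      ultimately have "m x = 0" using m_le[of u x] by auto
      then show ?thesis by (simp add: h_def)
    qed
    moreover have "topspace (geometric_realization L) \<subseteq> topspace (geometric_realization K)"
      unfolding tK tL by (auto simp: L_def)
    ultimately show ?thesis
      using into[of 1] by (auto simp: retraction_maps_def continuous_map_geometric_realization)
  qed
  have "homotopic_with (\<lambda>_. True) (geometric_realization K) (geometric_realization K) id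
      (\<lambda>x. h (1, x))"
    by (rule homotopic_with_geometric_realization[OF cont]) (use into in \<open>auto simp: h_def\<close>)
  then have "homotopic_with (\<lambda>_. True) (geometric_realization K) (geometric_realization K)
      (id \<circ> (\<lambda>x. h (1, x))) id"
    by (simp add: homotopic_with_sym)
  from deformation_retraction_imp_homotopy_equivalent_space[OF this r] show ?thesis
    by (simp add: L_def)
qed

section \<open>Deleting a vertex with collapsible link\<close>

definition link :: "'a set set \<Rightarrow> 'a \<Rightarrow> 'a set set" where
  "link K w = {S. w \<notin> S \<and> insert w S \<in> K}"

inductive collapsible :: "'a set set \<Rightarrow> bool" where
  empty: "collapsible {}"
| step: "\<lbrakk>finite \<sigma>; v \<notin> \<sigma>; \<And>S. \<lbrakk>S \<in> L; \<sigma> \<subseteq> S\<rbrakk> \<Longrightarrow> insert v S \<in> L;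
    collapsible {S \<in> L. \<not> \<sigma> \<subseteq> S}\<rbrakk> \<Longrightarrow> collapsible L"

text \<open>A collapse of the link at \<open>\<sigma>\<close> towards \<open>v\<close> is a collapse
  of \<open>K\<close> at \<open>insert w \<sigma>\<close> towards the same \<open>v\<close>. Once
  the link has become \<open>{}\<close>, no face contains \<open>w\<close>.\<close>

lemma delete_vertex_homotopy_equivalent:
  assumes "collapsible L" "L = link K w" "finite V" "K \<subseteq> Pow V" "down_closed K"
  shows "geometric_realization K homotopy_equivalent_space geometric_realization {S \<in> K. w \<notin> S}"
  using assms
proof (induction L arbitrary: K rule: collapsible.induct)
  case empty
  have "w \<notin> S" if "S \<in> K" for S
    using empty.prems that by (auto simp: link_def insert_absorb dest!: spec[of _ "S - {w}"])
  then have "{S \<in> K. w \<notin> S} = K" by auto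
  then show ?case by (simp add: homotopy_equivalent_space_refl)
next
  case (step \<sigma> v L)
  let ?K = "{S \<in> K. \<not> insert w \<sigma> \<subseteq> S}"
  show ?case
  \<comment> \<open>No face of the link contains \<open>w\<close>, so in the first case no face
    contains \<open>\<sigma>\<close> and the step is vacuous.\<close>
  proof (cases "w \<in> \<sigma> \<or> w = v")
    case True
    then have "\<not> \<sigma> \<subseteq> S" if "S \<in> L" for S
      using step.hyps(3)[of S] that step.prems(1) by (auto simp: link_def)
    then have "{S \<in> L. \<not> \<sigma> \<subseteq> S} = L" by auto
    then show ?thesis
      by (intro step.IH) (simp_all add: step.prems)
  next
    case False
    have "geometric_realization K homotopy_equivalent_space geometric_realization ?K"
    proof (rule collapse_homotopy_equivalent[OF step.prems(2,3,4), where v = v])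
      fix S assume S: "S \<in> K" "insert w \<sigma> \<subseteq> S"
      then have "S - {w} \<in> L" "\<sigma> \<subseteq> S - {w}"
        using step.prems(1) False by (auto simp: link_def insert_absorb)
      then have "insert v (S - {w}) \<in> link K w" using step.hyps(3) step.prems(1) by auto
      then have "insert w (insert v (S - {w})) \<in> K" by (simp add: link_def)
      then show "insert v S \<in> K" using S by (simp add: insert_commute insert_absorb)
    qed (use step.hyps False in auto)
    also have "geometric_realization ?K homotopy_equivalent_space
        geometric_realization {S \<in> ?K. w \<notin> S}"
    proof (rule step.IH)
      show "{S \<in> L. \<not> \<sigma> \<subseteq> S} = link ?K w"
        using step.prems(1) False by (auto simp: link_def)
      show "?K \<subseteq> Pow V" using step.prems by auto
      show "down_closed ?K" using step.prems(4) unfolding down_closed_def by blast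
    qed (use step in auto)
    also have "{S \<in> ?K. w \<notin> S} = {S \<in> K. w \<notin> S}" by auto
    finally show ?thesis .
  qed
qed

text \<open>The vertices are removed in decreasing order, each being dominated by its predecessor.\<close>

lemma collapsible_if_dominated:
  fixes L :: "nat set set"
  assumes L: "L \<subseteq> Pow {a..b}"
    and base: "\<And>S. S \<in> L \<Longrightarrow> S \<subseteq> {a} \<Longrightarrow> insert a S \<in> L"
    and dom: "\<And>S j. \<lbrakk>S \<in> L; Suc j \<in> S; a \<le> j; S \<subseteq> {..Suc j}\<rbrakk> \<Longrightarrow> insert j S \<in> L"
  shows "collapsible L"
proof -
  have "collapsible {S \<in> L. S \<subseteq> {..a + n}}" for n
  proof (induction n)
    case 0
    have sub: "S \<subseteq> {a}" if "S \<in> L" "S \<subseteq> {..a}" for S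
    proof
      fix x assume "x \<in> S"
      then have "x \<in> {a..b}" "x \<in> {..a}" using L that by blast+
      then show "x \<in> {a}" by simp
    qed
    \<comment> \<open>What is left lives on the single vertex \<open>a\<close> and is a cone over it
      or has no face at all, so one step with empty \<open>\<sigma>\<close> finishes.\<close>
    show ?case
      by (rule collapsible.step[of "{}" a]) (use base sub in \<open>auto simp: collapsible.empty\<close>)
  next
    case (Suc n)
    have rest: "{S \<in> {S \<in> L. S \<subseteq> {..a + Suc n}}. \<not> {a + Suc n} \<subseteq> S} = {S \<in> L. S \<subseteq> {..a + n}}"
    proof -
      have "{..a + Suc n} = insert (a + Suc n) {..a + n}" "a + Suc n \<notin> {..a + n}" by auto
      then have "S \<subseteq> {..a + Suc n} \<and> a + Suc n \<notin> S \<longleftrightarrow> S \<subseteq> {..a + n}" for S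
        by (simp only:) blast
      then show ?thesis by (simp add: conj_assoc)
    qed
    have dom': "insert (a + n) S \<in> {S \<in> L. S \<subseteq> {..a + Suc n}}"
      if "S \<in> {S \<in> L. S \<subseteq> {..a + Suc n}}" "{a + Suc n} \<subseteq> S" for S
      using that dom[of S "a + n"] by simp
    show ?case
    proof (rule collapsible.step[of "{a + Suc n}" "a + n"])
      show "collapsible {S \<in> {S \<in> L. S \<subseteq> {..a + Suc n}}. \<not> {a + Suc n} \<subseteq> S}"
        unfolding rest by (rule Suc)
    qed (use dom' in auto)
  qed
  moreover have "{S \<in> L. S \<subseteq> {..a + b}} = L"
  proof -
    have "{a..b} \<subseteq> {..a + b}" by auto
    with L show ?thesis by blast
  qed
  ultimately show ?thesis by metis
qed

section \<open>Quotients and wedges\<close>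

text \<open>\<open>H\<close> plays the role of the extended contraction in the usual proof that
  collapsing a contractible subspace with the homotopy extension property is a homotopy equivalence.
  The inverse map is induced by \<open>H (1, _)\<close>, which is constant on \<open>A\<close>, and
  \<open>q \<circ> H\<close> descends to a homotopy on \<open>W\<close> because \<open>H\<close>
  keeps \<open>A\<close> inside itself.\<close>

lemma homotopy_equivalent_space_collapse:
  fixes H :: "real \<times> 'a \<Rightarrow> 'a"
  assumes X: "compact_space X" and W: "Hausdorff_space W"
    and q: "continuous_map X W q" "q ` topspace X = topspace W"
    and A: "A \<subseteq> topspace X"
    and fibre: "\<And>x y. \<lbrakk>x \<in> topspace X; y \<in> topspace X\<rbrakk> \<Longrightarrow> q x = q y \<longleftrightarrow> x = y \<or> x \<in> A \<and> y \<in> A"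
    and H: "continuous_map (prod_topology (top_of_set {0..1}) X) X H"
    and H0: "\<And>x. x \<in> topspace X \<Longrightarrow> H (0, x) = x"
    and HA: "\<And>t x. \<lbrakk>t \<in> {0..1}; x \<in> A\<rbrakk> \<Longrightarrow> H (t, x) \<in> A"
    and H1: "\<And>x. x \<in> A \<Longrightarrow> H (1, x) = a"
  shows "X homotopy_equivalent_space W"
proof -
  let ?I = "top_of_set {0..1::real}"
  have HX: "H (t, x) \<in> topspace X" if "t \<in> {0..1}" "x \<in> topspace X" for t x
    using continuous_map_image_subset_topspace[OF H] that by auto
  have qm: "quotient_map X W q"
    by (rule continuous_imp_quotient_map[OF q(1) X W q(2)])
  have cH1: "continuous_map X X (\<lambda>x. H (1, x))"
    using continuous_map_o_Pair[OF H, of 1] by (simp add: o_def)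
  obtain g where g: "continuous_map W X g" "\<And>x. x \<in> topspace X \<Longrightarrow> g (q x) = H (1, x)"
  proof (rule quotient_map_lift_exists[OF qm cH1])
    show "H (1, x) = H (1, y)" if "x \<in> topspace X" "y \<in> topspace X" "q x = q y" for x y
      using fibre[OF that(1,2)] that(3) H1 by auto
  qed blast
  have "continuous_map (prod_topology ?I X) (prod_topology ?I W) (\<lambda>(t, x). (t, q x))"
    using continuous_map_compose[OF continuous_map_snd q(1), of ?I] continuous_map_fst[of ?I X]
    by (simp add: continuous_map_pairwise o_def case_prod_unfold)
  \<comment> \<open>The product of \<open>q\<close> with the interval is again a quotient map, since
    the source is compact and the target Hausdorff.\<close>
  then have qmI: "quotient_map (prod_topology ?I X) (prod_topology ?I W) (\<lambda>(t, x). (t, q x))"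
  proof (rule continuous_imp_quotient_map)
    show "(\<lambda>(t, x). (t, q x)) ` topspace (prod_topology ?I X) = topspace (prod_topology ?I W)"
      using q(2) by force
  qed (use X W in \<open>auto simp: compact_space_prod_topology Hausdorff_space_prod_topology
        compact_space_subtopology compactin_euclidean_iff Hausdorff_space_subtopology\<close>)
  obtain K where K: "continuous_map (prod_topology ?I W) W K"
    "\<And>p. p \<in> topspace (prod_topology ?I X) \<Longrightarrow> K ((\<lambda>(t, x). (t, q x)) p) = (q \<circ> H) p"
  proof (rule quotient_map_lift_exists[OF qmI continuous_map_compose[OF H q(1)]])
    fix p p'
    assume p: "p \<in> topspace (prod_topology ?I X)" "p' \<in> topspace (prod_topology ?I X)"
      "(case p of (t, x) \<Rightarrow> (t, q x)) = (case p' of (t, x) \<Rightarrow> (t, q x))"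
    obtain t x x' where eq: "p = (t, x)" "p' = (t, x')" "q x = q x'"
      using p(3) by (cases p; cases p') auto
    then have t: "t \<in> {0..1}" "x \<in> topspace X" "x' \<in> topspace X" using p by auto
    have "q (H (t, x)) = q (H (t, x'))"
    proof (cases "x = x'")
      case False
      then have "x \<in> A" "x' \<in> A" using fibre[OF t(2,3)] eq(3) by blast+
      then show ?thesis using fibre[OF HX[OF t(1,2)] HX[OF t(1,3)]] HA[OF t(1)] by blast
    qed simp
    then show "(q \<circ> H) p = (q \<circ> H) p'" using eq by simp
  qed blast
  have "homotopic_with (\<lambda>_. True) X X id (g \<circ> q)"
    by (rule homotopic_with_TrueI[OF H]) (simp_all add: H0 g(2))
  moreover have "homotopic_with (\<lambda>_. True) W W id (q \<circ> g)"
  proof -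
    have "K (0, w) = w \<and> K (1, w) = q (g w)" if "w \<in> topspace W" for w
    proof -
      have "w \<in> q ` topspace X" using that by (simp add: q(2))
      then obtain x where x: "x \<in> topspace X" "w = q x" by blast
      have "K (0, q x) = q (H (0, x))" "K (1, q x) = q (H (1, x))"
        using K(2)[of "(0, x)"] K(2)[of "(1, x)"] x(1) by simp_all
      then show ?thesis unfolding x(2) H0[OF x(1)] g(2)[OF x(1)] by (rule conjI)
    qed
    then show ?thesis
      by (intro homotopic_with_TrueI[OF K(1)]) simp_all
  qed
  ultimately have "homotopic_with (\<lambda>_. True) X X (g \<circ> q) id"
      "homotopic_with (\<lambda>_. True) W W (q \<circ> g) id"
    by (auto intro: homotopic_with_symD)
  with q(1) g(1) show ?thesis
    unfolding homotopy_equivalent_space_def by (intro exI[of _ q] exI[of _ g] conjI)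
qed

lemma continuous_map_from_sum_topology:
  assumes "\<And>i. i \<in> I \<Longrightarrow> continuous_map (X i) Y (\<lambda>x. f (i, x))"
  shows "continuous_map (sum_topology X I) Y f"
proof -
  have "openin (X i) {x. (i, x) \<in> {z \<in> Sigma I (topspace \<circ> X). f z \<in> U}}"
    if "i \<in> I" "openin Y U" for i U
    using openin_continuous_map_preimage[OF assms[OF that(1)] that(2)] that(1) by simp
  moreover have "f z \<in> topspace Y" if "z \<in> Sigma I (topspace \<circ> X)" for z
    using that continuous_map_image_subset_topspace[OF assms, of "fst z"] by (cases z) auto
  ultimately show ?thesis
    by (auto simp: continuous_map openin_sum_topology)
qed

text \<open>The retractions \<open>r j\<close> onto the summands, sending all other summands to the
  base point, jointly separate points; the disjoint neighbourhoods are pulled back from one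
  summand.\<close>

lemma Hausdorff_space_wedge_topology:
  assumes I: "I \<noteq> {}" and p: "\<And>i. i \<in> I \<Longrightarrow> p i \<in> topspace (X i)"
    and X: "\<And>i. i \<in> I \<Longrightarrow> Hausdorff_space (X i)"
  shows "Hausdorff_space (wedge_topology X p I)"
proof -
  let ?W = "wedge_topology X p I"
  define r where "r j w = (case w of None \<Rightarrow> p j | Some (i, x) \<Rightarrow> if i = j then x else p j)" for j w
  have r: "continuous_map ?W (X j) (r j)" if j: "j \<in> I" for j
  proof (rule continuous_compose_quotient_map[OF quotient_map_wedge_collapse[OF I p]])
    show "continuous_map (sum_topology X I) (X j) (r j \<circ> wedge_collapse p)"
    proof (rule continuous_map_from_sum_topology)
      fix i assume "i \<in> I"
      have "continuous_map (X i) (X j) (\<lambda>x. if i = j then x else p j)"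
        using p[OF j] by (cases "i = j") auto
      then show "continuous_map (X i) (X j) (\<lambda>x. (r j \<circ> wedge_collapse p) (i, x))"
        by (rule continuous_map_eq) (auto simp: r_def)
    qed
  qed
  show ?thesis
    unfolding Hausdorff_space_def
  proof clarify
    fix w w' assume w: "w \<in> topspace ?W" "w' \<in> topspace ?W" "w \<noteq> w'"
    then obtain j where j: "j \<in> I" "r j w \<noteq> r j w'"
      by (fastforce simp: topspace_wedge_topology r_def split: if_splits)
    have "r j w \<in> topspace (X j)" "r j w' \<in> topspace (X j)"
      using r[OF j(1)] w continuous_map_image_subset_topspace by blast+
    then obtain U V where UV: "openin (X j) U" "openin (X j) V" "r j w \<in> U" "r j w' \<in> V" "disjnt U V"
      using X[OF j(1)] j(2) unfolding Hausdorff_space_def by blast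
    show "\<exists>U V. openin ?W U \<and> openin ?W V \<and> w \<in> U \<and> w' \<in> V \<and> disjnt U V"
    proof (intro exI conjI)
      show "openin ?W {w \<in> topspace ?W. r j w \<in> U}" "openin ?W {w \<in> topspace ?W. r j w \<in> V}"
        using r[OF j(1)] UV openin_continuous_map_preimage by blast+
      show "disjnt {w \<in> topspace ?W. r j w \<in> U} {w \<in> topspace ?W. r j w \<in> V}"
        using UV(5) by (auto simp: disjnt_iff)
    qed (use w UV in auto)
  qed
qed

lemma Hausdorff_space_nsphere: "Hausdorff_space (nsphere n)"
  unfolding nsphere_def by (intro Hausdorff_space_subtopology Hausdorff_Euclidean_space)

section \<open>The triangle modulo its boundary\<close>

text \<open>Dividing by \<open>min p q r\<close> maps the open triangle homeomorphically onto the plane; this is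
  followed by the inverse stereographic projection, which clears the denominator and so extends to
  the boundary.\<close>

definition triangle_to_sphere :: "real \<Rightarrow> real \<Rightarrow> real \<Rightarrow> nat \<Rightarrow> real" where
  "triangle_to_sphere p q r =
    (let m = min p (min q r); d = (p - r)\<^sup>2 + (q - r)\<^sup>2 + m\<^sup>2
     in (\<lambda>i. if i = 0 then ((p - r)\<^sup>2 + (q - r)\<^sup>2 - m\<^sup>2) / d
             else if i = 1 then 2 * (p - r) * m / d
             else if i = 2 then 2 * (q - r) * m / d else 0))"

lemma triangle_denominator_pos:
  fixes p q r :: real
  assumes "p + q + r = 1"
  shows "(p - r)\<^sup>2 + (q - r)\<^sup>2 + (min p (min q r))\<^sup>2 > 0"
proof (rule ccontr)
  assume "\<not> ?thesis"
  then have "(p - r)\<^sup>2 + (q - r)\<^sup>2 + (min p (min q r))\<^sup>2 = 0"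
    by (smt (verit) zero_le_power2)
  then have "(p - r)\<^sup>2 = 0" "(q - r)\<^sup>2 = 0" "(min p (min q r))\<^sup>2 = 0"
    by (smt (verit) zero_le_power2)+
  then have "p = r" "q = r" "min p (min q r) = 0" by simp_all
  with assms show False by simp
qed

lemma triangle_to_sphere_in_nsphere:
  assumes "p + q + r = 1"
  shows "triangle_to_sphere p q r \<in> topspace (nsphere 2)"
proof -
  define m where "m = min p (min q r)"
  define X where "X = p - r"
  define Y where "Y = q - r"
  define d where "d = X\<^sup>2 + Y\<^sup>2 + m\<^sup>2"
  have "d > 0" using triangle_denominator_pos[OF assms] by (simp add: d_def X_def Y_def m_def)
  have "((X\<^sup>2 + Y\<^sup>2 - m\<^sup>2) / d)\<^sup>2 + (2 * X * m / d)\<^sup>2 + (2 * Y * m / d)\<^sup>2 =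
      ((X\<^sup>2 + Y\<^sup>2 - m\<^sup>2)\<^sup>2 + (2 * X * m)\<^sup>2 + (2 * Y * m)\<^sup>2) / d\<^sup>2"
    by (simp add: power_divide add_divide_distrib)
  also have "(X\<^sup>2 + Y\<^sup>2 - m\<^sup>2)\<^sup>2 + (2 * X * m)\<^sup>2 + (2 * Y * m)\<^sup>2 = d\<^sup>2"
    unfolding d_def by algebra
  also have "d\<^sup>2 / d\<^sup>2 = 1" using \<open>d > 0\<close> by simp
  finally show ?thesis
    by (simp add: nsphere triangle_to_sphere_def Let_def X_def Y_def m_def d_def eval_nat_numeral
        split del: if_split)
qed

text \<open>Dividing by \<open>1 - y 0\<close> is part of the stereographic projection from the base
  point. This closed form shows when the divisor vanishes and cancels in the quotients
  below.\<close>

lemma triangle_to_sphere_1_minus: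
  assumes "p + q + r = 1"
  shows "1 - triangle_to_sphere p q r 0 =
    2 * (min p (min q r))\<^sup>2 / ((p - r)\<^sup>2 + (q - r)\<^sup>2 + (min p (min q r))\<^sup>2)"
  using triangle_denominator_pos[OF assms]
  by (simp add: triangle_to_sphere_def Let_def field_simps)

lemma triangle_to_sphere_basepoint:
  assumes "p + q + r = 1"
  shows "triangle_to_sphere p q r = nsphere_basepoint \<longleftrightarrow> min p (min q r) = 0"
proof
  assume "triangle_to_sphere p q r = nsphere_basepoint"
  then have "1 - triangle_to_sphere p q r 0 = 0" by (simp add: nsphere_basepoint_def)
  then show "min p (min q r) = 0"
    using triangle_denominator_pos[OF assms] by (simp add: triangle_to_sphere_1_minus[OF assms])
next
  assume "min p (min q r) = 0"
  then show "triangle_to_sphere p q r = nsphere_basepoint"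
    using triangle_denominator_pos[OF assms]
    by (auto simp: triangle_to_sphere_def Let_def nsphere_basepoint_def fun_eq_iff)
qed

text \<open>Dividing \<open>m = r + m * min a (min b 0)\<close> by \<open>m\<close> yields
  \<open>r / m\<close>, and the sum 1 then fixes \<open>m\<close>. So the plane coordinates
  \<open>(a, b)\<close> determine the point of the open triangle.\<close>

lemma triangle_coordinates:
  fixes p q r :: real
  assumes "p + q + r = 1" "min p (min q r) = m" "m > 0"
  defines "a \<equiv> (p - r) / m" and "b \<equiv> (q - r) / m"
  shows "m = 1 / (3 + a + b - 3 * min a (min b 0))" "r = m * (1 - min a (min b 0))"
    "p = r + m * a" "q = r + m * b"
proof -
  have p: "p = r + m * a" and q: "q = r + m * b" using assms by (auto simp: field_simps)
  have "min p (min q r) = r + m * min a (min b 0)"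
    using \<open>m > 0\<close> unfolding p q by (simp add: min_def mult_le_cancel_left mult_le_0_iff zero_le_mult_iff)
  then show r: "r = m * (1 - min a (min b 0))"
    using assms(2) by (simp add: algebra_simps)
  have "m * (3 + a + b - 3 * min a (min b 0)) = 1"
    using assms(1) r unfolding p q by (simp add: algebra_simps)
  then show "m = 1 / (3 + a + b - 3 * min a (min b 0))"
    by (metis nonzero_eq_divide_eq mult_zero_right zero_neq_one)
  show "p = r + m * a" "q = r + m * b" by fact+
qed

text \<open>Stereographic projection undoes its inverse and so recovers the plane coordinates of
  \<open>triangle_coordinates\<close>.\<close>

lemma triangle_to_sphere_ratio:
  assumes "p + q + r = 1" "min p (min q r) \<noteq> 0"
  shows "triangle_to_sphere p q r 1 / (1 - triangle_to_sphere p q r 0) = (p - r) / min p (min q r)"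
    and "triangle_to_sphere p q r 2 / (1 - triangle_to_sphere p q r 0) = (q - r) / min p (min q r)"
proof -
  have *: "(2 * X * m / d) / (2 * m\<^sup>2 / d) = X / m" if "d > 0" "m \<noteq> 0" for X m d :: real
    using that by (simp add: power2_eq_square)
  show "triangle_to_sphere p q r 1 / (1 - triangle_to_sphere p q r 0) = (p - r) / min p (min q r)"
    "triangle_to_sphere p q r 2 / (1 - triangle_to_sphere p q r 0) = (q - r) / min p (min q r)"
    unfolding triangle_to_sphere_1_minus[OF assms(1)] *[OF triangle_denominator_pos[OF assms(1)] assms(2), symmetric]
    by (simp_all add: triangle_to_sphere_def Let_def)
qed

lemma triangle_to_sphere_inject:
  assumes "p + q + r = 1" "min p (min q r) > 0" "p' + q' + r' = 1" "min p' (min q' r') > 0"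
    and eq: "triangle_to_sphere p q r = triangle_to_sphere p' q' r'"
  shows "p = p' \<and> q = q' \<and> r = r'"
proof -
  have "(p - r) / min p (min q r) = (p' - r') / min p' (min q' r')"
    "(q - r) / min p (min q r) = (q' - r') / min p' (min q' r')"
    using triangle_to_sphere_ratio[of p q r] triangle_to_sphere_ratio[of p' q' r'] assms by auto
  with triangle_coordinates[OF assms(1) refl assms(2)] triangle_coordinates[OF assms(3) refl assms(4)]
  show ?thesis by metis
qed

lemma triangle_to_sphere_surj:
  assumes y: "y \<in> topspace (nsphere 2)" "y \<noteq> nsphere_basepoint"
  obtains p q r where "p > 0" "q > 0" "r > 0" "p + q + r = 1" "triangle_to_sphere p q r = y"
proof -
  have sq: "(y 0)\<^sup>2 + (y 1)\<^sup>2 + (y 2)\<^sup>2 = 1" and y0: "\<And>i. i > 2 \<Longrightarrow> y i = 0"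
    using y(1) by (auto simp: nsphere eval_nat_numeral)
  have ne: "y 0 \<noteq> 1"
  proof
    assume "y 0 = 1"
    with sq have "(y 1)\<^sup>2 = 0" "(y 2)\<^sup>2 = 0" by (smt (verit) one_power2 zero_le_power2)+
    then have "y i = nsphere_basepoint i" for i
      using \<open>y 0 = 1\<close> y0[of i] by (cases "i = 0 \<or> i = 1 \<or> i = 2") (auto simp: nsphere_basepoint_def)
    with y(2) show False by auto
  qed
  \<comment> \<open>\<open>(a, b)\<close> is the stereographic projection of \<open>y\<close>; the
    values of \<open>m\<close>, \<open>p\<close>, \<open>q\<close>, \<open>r\<close> are then those
    dictated by \<open>triangle_coordinates\<close>.\<close>
  define a where "a = y 1 / (1 - y 0)"
  define b where "b = y 2 / (1 - y 0)"
  define c where "c = min a (min b 0)"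
  have c: "c \<le> a" "c \<le> b" "c \<le> 0" "c = a \<or> c = b \<or> c = 0" by (auto simp: c_def)
  define m where "m = 1 / (3 + a + b - 3 * c)"
  have pos: "3 + a + b - 3 * c > 0" using c by linarith
  then have m: "m > 0" by (simp add: m_def)
  define p q r where "p = m * (1 + a - c)" and "q = m * (1 + b - c)" and "r = m * (1 - c)"
  have sum1: "p + q + r = 1"
  proof -
    have "p + q + r = m * (3 + a + b - 3 * c)" by (simp add: p_def q_def r_def algebra_simps)
    then show ?thesis using pos by (simp add: m_def)
  qed
  have "m \<le> p" "m \<le> q" "m \<le> r"
    using m c by (simp_all add: p_def q_def r_def)
  moreover have "p = m \<or> q = m \<or> r = m" using c(4) by (auto simp: p_def q_def r_def)
  ultimately have min: "min p (min q r) = m" by (auto simp: min_def)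
  have dif: "p - r = m * a" "q - r = m * b" by (simp_all add: p_def q_def r_def algebra_simps)
  \<comment> \<open>This uses that \<open>y\<close> lies on the unit sphere. It turns the
    denominator of \<open>triangle_to_sphere\<close> into
    \<open>m\<^sup>2 * (2 / (1 - y 0))\<close>, from which \<open>m\<close> cancels.\<close>
  have R: "a\<^sup>2 + b\<^sup>2 + 1 = 2 / (1 - y 0)"
  proof -
    have "a\<^sup>2 + b\<^sup>2 + 1 = ((y 1)\<^sup>2 + (y 2)\<^sup>2 + (1 - y 0)\<^sup>2) / (1 - y 0)\<^sup>2"
      using ne by (simp add: a_def b_def power_divide add_divide_distrib)
    also have "(y 1)\<^sup>2 + (y 2)\<^sup>2 + (1 - y 0)\<^sup>2 = 2 * (1 - y 0)" using sq by algebra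
    also have "2 * e / e\<^sup>2 = 2 / e" for e :: real by (simp add: power2_eq_square)
    finally show ?thesis .
  qed
  have d: "(m * a)\<^sup>2 + (m * b)\<^sup>2 + m\<^sup>2 = m\<^sup>2 * (2 / (1 - y 0))"
    unfolding R[symmetric] by (simp add: algebra_simps power_mult_distrib)
  have R': "a\<^sup>2 + b\<^sup>2 - 1 = 2 * y 0 / (1 - y 0)"
  proof -
    have "2 / (1 - y 0) - 2 = 2 * y 0 / (1 - y 0)" using ne by (simp add: field_simps)
    with R show ?thesis by linarith
  qed
  have d': "(m * a)\<^sup>2 + (m * b)\<^sup>2 - m\<^sup>2 = m\<^sup>2 * (2 * y 0 / (1 - y 0))"
    unfolding R'[symmetric] by (simp add: algebra_simps power_mult_distrib)
  have "triangle_to_sphere p q r i = y i" for i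
  proof -
    have "a * (1 - y 0) = y 1" "b * (1 - y 0) = y 2" using ne by (simp_all add: a_def b_def)
    moreover have "m\<^sup>2 * (2 * z / e) / (m\<^sup>2 * (2 / e)) = z" "2 * (m * x) * m / (m\<^sup>2 * (2 / e)) = x * e"
      if "e \<noteq> 0" for x z e :: real
      using that m by (simp_all add: power2_eq_square)
    ultimately show ?thesis
      using m ne y0[of i]
      by (cases "i = 0 \<or> i = 1 \<or> i = 2")
        (auto simp: triangle_to_sphere_def Let_def min dif d d')
  qed
  then have "triangle_to_sphere p q r = y" by auto
  with sum1 m \<open>m \<le> p\<close> \<open>m \<le> q\<close> \<open>m \<le> r\<close> show thesis by (intro that[of p q r]) simp_all
qed

lemma continuous_on_triangle_to_sphere:
  assumes "continuous_on S f" "continuous_on S g" "continuous_on S h"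
    and "\<And>x. x \<in> S \<Longrightarrow> f x + g x + h x = 1"
  shows "continuous_on S (\<lambda>x. triangle_to_sphere (f x) (g x) (h x))"
proof (rule continuous_on_coordinatewise_then_product)
  fix i
  have "(f x - h x)\<^sup>2 + (g x - h x)\<^sup>2 + (min (f x) (min (g x) (h x)))\<^sup>2 \<noteq> 0" if "x \<in> S" for x
    using triangle_denominator_pos[OF assms(4)[OF that]] by simp
  then show "continuous_on S (\<lambda>x. triangle_to_sphere (f x) (g x) (h x) i)"
    unfolding triangle_to_sphere_def Let_def using assms
    by (cases "i = 0"; cases "i = 1"; cases "i = 2")
      (auto intro!: continuous_intros continuous_on_min)
qed

text \<open>The realization is a finite union of closed simplices \<open>?D S\<close>, each a closed
  subset of a cube, which is compact by Tychonoff. Compactness is what later makes the collapse a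
  quotient map.\<close>

lemma compact_space_geometric_realization:
  assumes V: "finite V" "K \<subseteq> Pow V" and K: "down_closed K"
  shows "compact_space (geometric_realization K)"
proof -
  let ?D = "\<lambda>S. {x :: 'a \<Rightarrow> real. (\<forall>v. x v \<in> {0..1}) \<and> (\<forall>v. v \<notin> S \<longrightarrow> x v = 0) \<and> sum x V = 1}"
  have "compact (?D S)" for S :: "'a set"
  proof -
    have "compactin (product_topology (\<lambda>_. euclideanreal) UNIV) (PiE UNIV (\<lambda>_::'a. {0..1::real}))"
      by (simp add: compactin_PiE)
    then have "compact (PiE UNIV (\<lambda>_::'a. {0..1::real}))"
      by (simp add: euclidean_product_topology)
    moreover have "closed {x. (\<forall>v. v \<notin> S \<longrightarrow> x v = 0) \<and> sum x V = (1::real)}"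
      by (intro closed_Collect_conj closed_Collect_all closed_Collect_imp closed_Collect_eq
          continuous_intros continuous_on_product_then_coordinatewise) auto
    ultimately have "compact (PiE UNIV (\<lambda>_::'a. {0..1::real}) \<inter>
        {x. (\<forall>v. v \<notin> S \<longrightarrow> x v = 0) \<and> sum x V = 1})"
      by (rule compact_Int_closed)
    moreover have "PiE UNIV (\<lambda>_::'a. {0..1::real}) \<inter>
        {x. (\<forall>v. v \<notin> S \<longrightarrow> x v = 0) \<and> sum x V = 1} = ?D S"
      by (auto simp: PiE_def Pi_def)
    ultimately show ?thesis by simp
  qed
  moreover have "finite K" using V by (simp add: finite_subset)
  ultimately have "compact (\<Union>S\<in>K. ?D S)" by (intro compact_UN)
  moreover have "topspace (geometric_realization K) = (\<Union>S\<in>K. ?D S)"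
  proof (intro equalityI subsetI)
    fix x assume "x \<in> topspace (geometric_realization K)"
    then have x: "\<And>v. 0 \<le> x v" "{v. x v \<noteq> 0} \<in> K" "sum x V = 1"
      by (auto simp: topspace_geometric_realization[OF V])
    have "x v \<le> 1" for v
    proof (cases "v \<in> V")
      case True
      then show ?thesis using member_le_sum[of v V x] x V by auto
    next
      case False
      then have "v \<notin> {v. x v \<noteq> 0}" using x(2) V by blast
      then show ?thesis by simp
    qed
    then have "x \<in> ?D {v. x v \<noteq> 0}" using x by auto
    then show "x \<in> (\<Union>S\<in>K. ?D S)" using x(2) by (rule UN_I[rotated])
  next
    fix x assume "x \<in> (\<Union>S\<in>K. ?D S)"
    then obtain S where S: "S \<in> K" "x \<in> ?D S" by blast
    then have "{v. x v \<noteq> 0} \<subseteq> S" by auto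
    then have "{v. x v \<noteq> 0} \<in> K" using S(1) K down_closedD by blast
    then show "x \<in> topspace (geometric_realization K)"
      using S by (auto simp: topspace_geometric_realization[OF V])
  qed
  moreover obtain X where "geometric_realization K = top_of_set X"
    by (rule geometric_realization_top_of_set)
  ultimately show ?thesis by (simp add: compact_space_subtopology compactin_euclidean_iff)
qed

section \<open>Triangles attached to a collapsible complex\<close>

text \<open>\<open>w\<close> is a fresh apex. The point of the cone over \<open>A\<close> is that it
  contracts to \<open>w\<close> along straight lines, so the homotopy is explicit.\<close>

locale coned_triangles =
  fixes V :: "'a set" and w :: 'a and A T :: "'a set set"
  assumes V: "finite V" "w \<notin> V" "A \<subseteq> Pow V" "T \<subseteq> Pow V"
    and A: "down_closed A"
    and T: "T \<noteq> {}" "\<And>s. s \<in> T \<Longrightarrow> card s = 3" "T \<inter> A = {}"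
    and boundary: "\<And>s u. \<lbrakk>s \<in> T; u \<in> s\<rbrakk> \<Longrightarrow> s - {u} \<in> A"
begin

definition cone :: "'a set set" where
  "cone = A \<union> insert w ` A"

definition K :: "'a set set" where
  "K = cone \<union> T"

abbreviation X :: "('a \<Rightarrow> real) topology" where
  "X \<equiv> geometric_realization K"

text \<open>On a triangle this is the minimum used in \<open>triangle_to_sphere\<close>; on the
  realization of \<open>K\<close> it is positive only in the interior of \<open>s\<close>.\<close>

definition depth :: "'a set \<Rightarrow> ('a \<Rightarrow> real) \<Rightarrow> real" where
  "depth s x = Min (x ` s)"

lemma finite_T: "finite T"
  using V by (meson finite_Pow_iff finite_subset)

lemma T_finite: "s \<in> T \<Longrightarrow> finite s"
  using T(2) card.infinite by fastforce

lemma T_nonempty: "s \<in> T \<Longrightarrow> s \<noteq> {}"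
  using T(2) by fastforce

lemma empty_in_A: "{} \<in> A"
  using T(1) T_nonempty boundary A down_closedD by blast

lemma down_closed_cone: "down_closed cone"
  unfolding down_closed_def
proof (intro ballI allI impI)
  fix S S' assume S: "S \<in> cone" "S' \<subseteq> S"
  then obtain a where a: "a \<in> A" "S \<subseteq> insert w a" by (auto simp: cone_def)
  then have "S' - {w} \<in> A" using S A down_closedD[of A a "S' - {w}"] by blast
  then show "S' \<in> cone" by (cases "w \<in> S'") (auto simp: cone_def insert_absorb intro!: rev_image_eqI)
qed

lemma insert_w_in_cone: "S \<in> cone \<Longrightarrow> insert w S \<in> cone"
  by (auto simp: cone_def)

text \<open>An edge of a triangle of \<open>T\<close> lies in \<open>A\<close>, so together with
  \<open>w\<close> it spans a face of the cone. This is where the parts that stick out of a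
  stretched triangle go.\<close>

lemma subset_T_in_cone: "\<lbrakk>s \<in> T; u \<in> s; S \<subseteq> insert w (s - {u})\<rbrakk> \<Longrightarrow> S \<in> cone"
  using boundary[of s u] down_closedD[OF down_closed_cone, of "insert w (s - {u})" S]
  by (auto simp: cone_def)

text \<open>Faces of the cone avoiding \<open>w\<close> lie in \<open>A\<close>, which is disjoint
  from \<open>T\<close>, and all triangles have the same cardinality. Maximality is what lets a
  nonzero \<open>depth s\<close> determine the whole support.\<close>

lemma T_subset_K: "\<lbrakk>s \<in> T; S \<in> K; s \<subseteq> S\<rbrakk> \<Longrightarrow> S = s"
proof -
  assume s: "s \<in> T" "S \<in> K" "s \<subseteq> S"
  have "S \<notin> cone"
  proof
    assume "S \<in> cone"
    then have "s \<in> cone" using s down_closedD down_closed_cone by blast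
    moreover have "w \<notin> s" using s V by blast
    ultimately show False using s T by (auto simp: cone_def)
  qed
  then have "S \<in> T" using s by (simp add: K_def)
  then show "S = s" using s T card_subset_eq[OF T_finite] by metis
qed

lemma down_closed_K: "down_closed K"
  unfolding down_closed_def
proof (intro ballI allI impI)
  fix S S' assume S: "S \<in> K" "S' \<subseteq> S"
  show "S' \<in> K"
  proof (cases "S \<in> cone \<or> S' = S")
    case True
    then show ?thesis using S down_closedD[OF down_closed_cone] by (auto simp: K_def)
  next
    case False
    then have "S \<in> T" using S by (simp add: K_def)
    moreover obtain u where "u \<in> S" "S' \<subseteq> S - {u}" using False S by blast
    ultimately show ?thesis using subset_T_in_cone[of S u S'] by (auto simp: K_def)
  qed
qed

lemma K_subset: "K \<subseteq> Pow (insert w V)"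
  using V by (auto simp: K_def cone_def)

lemma topspace_X:
  "topspace X = {x. (\<forall>v. 0 \<le> x v) \<and> {v. x v \<noteq> 0} \<in> K \<and> sum x (insert w V) = 1}"
  using V K_subset by (intro topspace_geometric_realization) auto

lemma depth_nonneg: "\<lbrakk>x \<in> topspace X; s \<in> T\<rbrakk> \<Longrightarrow> 0 \<le> depth s x"
  using T_finite[of s] T_nonempty[of s] by (auto simp: depth_def topspace_X)

lemma depth_le: "\<lbrakk>s \<in> T; u \<in> s\<rbrakk> \<Longrightarrow> depth s x \<le> x u"
  using T_finite[of s] by (auto simp: depth_def)

lemma depth_eq: "s \<in> T \<Longrightarrow> \<exists>u\<in>s. depth s x = x u"
  using Min_in[of "x ` s"] T_finite[of s] T_nonempty[of s]
  by (metis depth_def finite_imageI image_is_empty imageE)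

lemma depth_nonzero_iff:
  assumes "x \<in> topspace X" "s \<in> T"
  shows "depth s x \<noteq> 0 \<longleftrightarrow> {v. x v \<noteq> 0} = s"
proof
  assume d: "depth s x \<noteq> 0"
  then have "x u \<noteq> 0" if "u \<in> s" for u
    using depth_le[OF assms(2) that, of x] depth_nonneg[OF assms] by auto
  then have "s \<subseteq> {v. x v \<noteq> 0}" by blast
  with T_subset_K[OF assms(2)] assms(1) show "{v. x v \<noteq> 0} = s" by (auto simp: topspace_X)
next
  assume "{v. x v \<noteq> 0} = s"
  with depth_eq[OF assms(2), of x] show "depth s x \<noteq> 0" by auto
qed

lemma not_in_cone_iff:
  assumes "x \<in> topspace X"
  shows "{v. x v \<noteq> 0} \<notin> cone \<longleftrightarrow> (\<exists>s\<in>T. {v. x v \<noteq> 0} = s)"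
proof -
  have "s \<notin> cone" if "s \<in> T" for s
    using that T V by (auto simp: cone_def)
  moreover have "{v. x v \<noteq> 0} \<in> K" using assms by (simp add: topspace_X)
  ultimately show ?thesis by (auto simp: K_def)
qed

lemma in_cone_iff:
  assumes "x \<in> topspace X"
  shows "{v. x v \<noteq> 0} \<in> cone \<longleftrightarrow> (\<forall>s\<in>T. depth s x = 0)"
  using not_in_cone_iff[OF assms] depth_nonzero_iff[OF assms] by blast

section \<open>The homotopy that contracts the cone\<close>

definition total_depth :: "('a \<Rightarrow> real) \<Rightarrow> real" where
  "total_depth x = (\<Sum>s\<in>T. depth s x)"

text \<open>On the cone \<open>m = 0\<close> and the factor is \<open>1 - t\<close>, as in the
  straight-line contraction to \<open>w\<close>. Stretching by \<open>1 + t\<close> about the centre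
  turns the minimal coordinate \<open>m\<close> into \<open>(1 + t) * m - t / 3\<close>; the two
  branches agree exactly when this is zero, where the stretched point starts to leave the triangle.
  At most one depth is nonzero at a point, so \<open>total_depth\<close> can stand for
  \<open>m\<close> and one formula serves all of \<open>X\<close>.\<close>

definition stretch :: "real \<Rightarrow> real \<Rightarrow> real" where
  "stretch t m = min (1 + t) (1 - t + 6 * (1 + t) * m)"

text \<open>At time \<open>t\<close> a triangle is stretched from its centre by the factor \<open>1 + t\<close>; what sticks out
  is pushed towards the apex \<open>w\<close>. The coordinate of \<open>w\<close> is whatever is missing to the sum \<open>1\<close>.\<close>

definition flow0 :: "real \<Rightarrow> ('a \<Rightarrow> real) \<Rightarrow> 'a \<Rightarrow> real" where
  "flow0 t x v = stretch t (total_depth x) * (x v - (\<Sum>s\<in>{s \<in> T. v \<in> s}. depth s x)) +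
     (\<Sum>s\<in>{s \<in> T. v \<in> s}. max 0 ((1 + t) * depth s x - t / 3))"

definition flow :: "real \<times> ('a \<Rightarrow> real) \<Rightarrow> 'a \<Rightarrow> real" where
  "flow p v = (if v = w then 1 - (\<Sum>u\<in>V. flow0 (fst p) (snd p) u) else flow0 (fst p) (snd p) v)"

lemma continuous_on_snd_apply: "continuous_on S (\<lambda>p :: 'b::topological_space \<times> ('a \<Rightarrow> real). snd p u)"
  by (rule continuous_on_product_then_coordinatewise[OF continuous_on_snd[OF continuous_on_id]])

lemma continuous_on_depth: "s \<in> T \<Longrightarrow> continuous_on S (\<lambda>p. depth s (snd p))"
  unfolding depth_def using T_finite T_nonempty
  by (intro continuous_on_Min_image continuous_on_snd_apply) auto

lemma continuous_on_flow: "continuous_on S flow"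
proof -
  have 0: "continuous_on S (\<lambda>p. flow0 (fst p) (snd p) v)" for v
    unfolding flow0_def stretch_def total_depth_def
    by (intro continuous_intros continuous_on_min continuous_on_max continuous_on_depth
        continuous_on_snd_apply) auto
  show ?thesis
  proof (rule continuous_on_coordinatewise_then_product)
    show "continuous_on S (\<lambda>p. flow p v)" for v
      unfolding flow_def using 0 by (cases "v = w") (auto intro!: continuous_intros)
  qed
qed

lemma sum_V: "x \<in> topspace X \<Longrightarrow> sum x V = 1 - x w"
  using V by (simp add: topspace_X)

text \<open>All depths vanish on the cone, so \<open>flow0\<close> is scaling by
  \<open>1 - t\<close> and the missing mass goes to \<open>w\<close>.\<close>

lemma flow_cone:
  assumes x: "x \<in> topspace X" "{v. x v \<noteq> 0} \<in> cone" and t: "t \<in> {0..1}"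
  shows "flow (t, x) v = (1 - t) * x v + (if v = w then t else 0)"
proof -
  have d: "depth s x = 0" if "s \<in> T" for s using in_cone_iff[OF x(1)] x(2) that by blast
  have f0: "flow0 t x v = (1 - t) * x v" for v
    using t d by (simp add: flow0_def total_depth_def stretch_def)
  have "(\<Sum>u\<in>V. flow0 t x u) = (1 - t) * (1 - x w)"
    unfolding f0 by (simp add: sum_V[OF x(1)] flip: sum_distrib_left)
  with f0 show ?thesis
    by (simp add: flow_def) (simp add: algebra_simps)
qed

lemma flow_triangle:
  assumes x: "x \<in> topspace X" "{v. x v \<noteq> 0} = s" and s: "s \<in> T" and t: "t \<in> {0..1}"
  defines "m \<equiv> depth s x"
  defines "m' \<equiv> max 0 ((1 + t) * m - t / 3)"
  shows "flow (t, x) v = (if v = w then 1 - stretch t m * (1 - 3 * m) - 3 * m'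
    else if v \<in> s then stretch t m * (x v - m) + m' else 0)"
proof -
  have d: "depth s' x = 0" if "s' \<in> T" "s' \<noteq> s" for s'
    using depth_nonzero_iff[OF x(1) that(1)] x(2) that(2) by blast
  \<comment> \<open>Only \<open>s\<close> has nonzero depth at \<open>x\<close>, so a sum over
    triangles of a function vanishing at 0 has at most one nonzero term.\<close>
  have sum_eq: "(\<Sum>s\<in>{s \<in> T. P s}. f (depth s x)) = (if P s then f m else 0)"
    if "f 0 = 0" for f :: "real \<Rightarrow> real" and P
  proof -
    have "(\<Sum>s\<in>{s \<in> T. P s}. f (depth s x)) = (\<Sum>s'\<in>{s \<in> T. P s}. if s' = s then f m else 0)"
      using d that by (intro sum.cong) (auto simp: m_def)
    then show ?thesis using s finite_T by simp
  qed
  have td: "total_depth x = m"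
    using sum_eq[of "\<lambda>m. m" "\<lambda>_. True"] by (simp add: total_depth_def)
  have f0: "flow0 t x v = (if v \<in> s then stretch t m * (x v - m) + m' else 0)" for v
  proof -
    have "(\<Sum>s\<in>{s \<in> T. v \<in> s}. max 0 ((1 + t) * depth s x - t / 3)) = (if v \<in> s then m' else 0)"
      unfolding m'_def using t by (intro sum_eq) simp
    moreover have "(\<Sum>s\<in>{s \<in> T. v \<in> s}. depth s x) = (if v \<in> s then m else 0)"
      using sum_eq[of "\<lambda>m. m"] by simp
    moreover have "v \<notin> s \<Longrightarrow> x v = 0" using x(2) by blast
    ultimately show ?thesis by (simp add: flow0_def td)
  qed
  have sV: "s \<subseteq> V" and ws: "w \<notin> s" using s V by blast+
  have "sum x V = 1" using sum_V[OF x(1)] ws x(2) by auto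
  moreover have "sum x V = sum x s"
    using sV V x(2) by (intro sum.mono_neutral_right) auto
  ultimately have sum_s: "sum x s = 1" by simp
  have "(\<Sum>u\<in>V. flow0 t x u) = (\<Sum>u\<in>s. stretch t m * (x u - m) + m')"
    unfolding f0 using sV V by (simp add: sum.If_cases Int_absorb1)
  also have "\<dots> = stretch t m * (\<Sum>u\<in>s. x u - m) + 3 * m'"
    using T(2)[OF s] by (simp add: sum.distrib flip: sum_distrib_left)
  also have "(\<Sum>u\<in>s. x u - m) = 1 - 3 * m"
    using T(2)[OF s] sum_s by (simp add: sum_subtractf)
  finally show ?thesis
    using ws by (simp add: flow_def f0)
qed

lemma flow_in_cone:
  assumes x: "x \<in> topspace X" "{v. x v \<noteq> 0} \<in> cone" and t: "t \<in> {0..1}"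
  shows "{v. flow (t, x) v \<noteq> 0} \<in> cone"
proof -
  have "{v. flow (t, x) v \<noteq> 0} \<subseteq> insert w {v. x v \<noteq> 0}"
    by (auto simp: flow_cone[OF assms])
  then show ?thesis
    using insert_w_in_cone[OF x(2)] down_closedD[OF down_closed_cone] by blast
qed

lemma flow_in_X:
  assumes x: "x \<in> topspace X" and t: "t \<in> {0..1}"
  shows "flow (t, x) \<in> topspace X"
proof -
  have x0: "0 \<le> x v" for v using x by (simp add: topspace_X)
  have "(\<Sum>u\<in>V. flow (t, x) u) = (\<Sum>u\<in>V. flow0 t x u)"
    using V by (intro sum.cong) (auto simp: flow_def)
  then have sum1: "sum (flow (t, x)) (insert w V) = 1"
    using V by (simp add: flow_def)
  have "(\<forall>v. 0 \<le> flow (t, x) v) \<and> {v. flow (t, x) v \<noteq> 0} \<in> K"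
  proof (cases "{v. x v \<noteq> 0} \<in> cone")
    case True
    then show ?thesis
      using flow_in_cone[OF x True t] t x0 by (simp add: flow_cone[OF x True t] K_def)
  next
    case False
    define s where "s = {v. x v \<noteq> 0}"
    have s: "s \<in> T" using False not_in_cone_iff[OF x] by (auto simp: s_def)
    define m where "m = depth s x"
    define m' where "m' = max 0 ((1 + t) * m - t / 3)"
    have fl: "flow (t, x) v = (if v = w then 1 - stretch t m * (1 - 3 * m) - 3 * m'
        else if v \<in> s then stretch t m * (x v - m) + m' else 0)" for v
      unfolding m_def m'_def by (rule flow_triangle[OF x s_def[symmetric] s t])
    have m0: "0 \<le> m" using depth_nonneg[OF x s] by (simp add: m_def)
    have mx: "m \<le> x v" if "v \<in> s" for v using depth_le[OF s that] by (simp add: m_def)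
    have t01: "0 \<le> t" "t \<le> 1" using t by auto
    have "0 \<le> 6 * (1 + t) * m" using m0 t01 by simp
    then have st: "0 \<le> stretch t m" using t01 by (simp add: stretch_def)
    show ?thesis
    \<comment> \<open>Either the stretched point is still in the triangle and \<open>w\<close>
      receives nothing, or it has left the triangle and the excess is moved to
      \<open>w\<close>.\<close>
    proof (cases "t / 3 \<le> (1 + t) * m")
      case True
      then have "1 + t \<le> 1 - t + 6 * (1 + t) * m" by linarith
      then have "stretch t m = 1 + t" by (simp add: stretch_def)
      moreover have "m' = (1 + t) * m - t / 3" unfolding m'_def using True by linarith
      ultimately have "1 - stretch t m * (1 - 3 * m) - 3 * m' = 0" by (simp add: algebra_simps)
      then have "\<forall>v. 0 \<le> flow (t, x) v" and "{v. flow (t, x) v \<noteq> 0} \<subseteq> s"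
        using st mx by (auto simp: fl m'_def intro!: add_nonneg_nonneg split: if_splits)
      moreover have "s \<in> K" using s by (simp add: K_def)
      ultimately show ?thesis using down_closedD[OF down_closed_K] by blast
    next
      case False
      then have m': "m' = 0" by (simp add: m'_def)
      have "1 - t + 6 * (1 + t) * m \<le> 1 + t" using False by linarith
      then have stretch: "stretch t m = 1 - t + 6 * (1 + t) * m" by (simp add: stretch_def)
      \<comment> \<open>The factorisation gives the sign of the coordinate of \<open>w\<close>: the
        first factor is nonnegative by the case assumption, which together with
        \<open>t \<le> 1\<close> also forces \<open>m \<le> 1 / 6\<close> and thus the sign of the
        second.\<close>
      have "1 - stretch t m * (1 - 3 * m) = (t - 3 * (1 + t) * m) * (1 - 6 * m)"
        unfolding stretch by algebra
      moreover have "6 * m \<le> 1"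
      proof (rule ccontr)
        assume "\<not> 6 * m \<le> 1"
        then have "(1 + t) * (1 / 6) \<le> (1 + t) * m" using t01 by (intro mult_left_mono) auto
        then have "(1 + t) * (1 / 6) < t / 3" using False by (meson le_less_trans not_le)
        with t01 show False by simp
      qed
      moreover have "3 * (1 + t) * m \<le> t" using False by linarith
      ultimately have w0: "0 \<le> 1 - stretch t m * (1 - 3 * m)" by (simp only:) simp
      \<comment> \<open>The vertex with the minimal coordinate drops out since
        \<open>m' = 0\<close>, leaving a face in the cone over the opposite edge.\<close>
      obtain u where u: "u \<in> s" "m = x u" using depth_eq[OF s] by (auto simp: m_def)
      have "\<forall>v. 0 \<le> flow (t, x) v"
        using st mx w0 by (simp add: fl m')
      moreover have "{v. flow (t, x) v \<noteq> 0} \<subseteq> insert w (s - {u})"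
        using u by (auto simp: fl m' split: if_splits)
      then have "{v. flow (t, x) v \<noteq> 0} \<in> K"
        using subset_T_in_cone[OF s u(1)] by (auto simp: K_def)
      ultimately show ?thesis by blast
    qed
  qed
  then show ?thesis using sum1 by (simp add: topspace_X)
qed

lemma flow_0:
  assumes "x \<in> topspace X"
  shows "flow (0, x) = x"
proof
  fix v
  have "(\<Sum>s\<in>{s \<in> T. v \<in> s}. max 0 (depth s x)) = (\<Sum>s\<in>{s \<in> T. v \<in> s}. depth s x)" for v
    using depth_nonneg[OF assms] by (intro sum.cong) auto
  moreover have "0 \<le> total_depth x"
    unfolding total_depth_def using depth_nonneg[OF assms] by (intro sum_nonneg) auto
  ultimately have "flow0 0 x v = x v" for v
    by (simp add: flow0_def stretch_def)
  then show "flow (0, x) v = x v"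
    using sum_V[OF assms] by (simp add: flow_def)
qed

text \<open>The map \<open>q\<close> sends the cone to the common base point and each triangle to
  its own sphere by \<open>triangle_to_sphere\<close>. It is glued from closed pieces, and
  \<open>flow\<close> supplies the homotopy for
  \<open>homotopy_equivalent_space_collapse\<close>.\<close>

lemma K_homotopy_equivalent_wedge_of_spheres:
  "geometric_realization K homotopy_equivalent_space wedge_of_spheres 2 (card T)"
proof -
  define n where "n = card T"
  let ?W = "wedge_of_spheres 2 n"
  let ?c = "wedge_collapse (\<lambda>_::nat. nsphere_basepoint)"
  have "n > 0" using T(1) finite_T by (simp add: n_def card_gt_0_iff)
  obtain e where e: "bij_betw e {..<n} T"
    using ex_bij_betw_nat_finite[OF finite_T] by (auto simp: n_def atLeast0LessThan)
  have eT: "e i \<in> T" if "i < n" for i using e that by (auto simp: bij_betw_def)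
  have "\<exists>a b c. e i = {a, b, c} \<and> a \<noteq> b \<and> a \<noteq> c \<and> b \<noteq> c" if "i < n" for i
    using T(2)[OF eT[OF that]] card_3_iff by metis
  then obtain a b c where abc: "\<And>i. i < n \<Longrightarrow> e i = {a i, b i, c i}"
      "\<And>i. i < n \<Longrightarrow> a i \<noteq> b i" "\<And>i. i < n \<Longrightarrow> a i \<noteq> c i" "\<And>i. i < n \<Longrightarrow> b i \<noteq> c i"
    by metis
  define face where "face i = {x \<in> topspace X. \<forall>v. v \<notin> e i \<longrightarrow> x v = 0}" for i
  define \<phi> where "\<phi> i x = triangle_to_sphere (x (a i)) (x (b i)) (x (c i))" for i and x :: "'a \<Rightarrow> real"
  have eV: "e i \<subseteq> V" if "i < n" for i using eT[OF that] V by blast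
  have face_sum: "x (a i) + x (b i) + x (c i) = 1" if "i < n" "x \<in> face i" for i x
  proof -
    have "sum x (insert w V) = sum x (e i)"
      using that eV[OF that(1)] V by (intro sum.mono_neutral_right) (auto simp: face_def)
    then have "sum x (e i) = 1" using that by (simp add: face_def topspace_X)
    then show ?thesis using abc[OF that(1)] by (simp add: add.assoc)
  qed
  have depth_e: "depth (e i) x = min (x (a i)) (min (x (b i)) (x (c i)))" if "i < n" for i x
    using abc[OF that] by (simp add: depth_def)
  have \<phi>_in: "\<phi> i x \<in> topspace (nsphere 2)" if "i < n" "x \<in> face i" for i x
    unfolding \<phi>_def by (rule triangle_to_sphere_in_nsphere[OF face_sum[OF that]])
  have \<phi>_base: "\<phi> i x = nsphere_basepoint \<longleftrightarrow> depth (e i) x = 0" if "i < n" "x \<in> face i" for i x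
    unfolding \<phi>_def depth_e[OF that(1)] by (rule triangle_to_sphere_basepoint[OF face_sum[OF that]])
  have face_supp: "x \<in> face i" if "x \<in> topspace X" "{v. x v \<noteq> 0} \<subseteq> e i" for i x
    using that by (auto simp: face_def)
  have W_def: "?W = wedge_topology (\<lambda>_. nsphere 2) (\<lambda>_. nsphere_basepoint) {..<n}"
    by (simp add: wedge_of_spheres_def)
  have topspace_W: "topspace ?W = insert None (?c ` ({..<n} \<times> topspace (nsphere 2)))"
    by (simp add: W_def topspace_wedge_topology o_def)
  have W: "Hausdorff_space ?W"
    unfolding W_def using \<open>n > 0\<close>
    by (intro Hausdorff_space_wedge_topology nsphere_basepoint Hausdorff_space_nsphere) auto
  obtain X0 where X0: "X = top_of_set X0" by (rule geometric_realization_top_of_set)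
  then have X0': "X0 = topspace X" by simp
  define piece where "piece j = (case j of None \<Rightarrow> {x \<in> topspace X. {v. x v \<noteq> 0} \<in> cone} | Some i \<Rightarrow> face i)"
    for j
  define f where "f j x = (case j of None \<Rightarrow> None | Some i \<Rightarrow> ?c (i, \<phi> i x))" for j x
  define J where "J = insert None (Some ` {..<n})"
  have f_None: "f (Some i) x = None \<longleftrightarrow> depth (e i) x = 0" if "i < n" "x \<in> face i" for i x
    using \<phi>_base[OF that] by (simp add: f_def)
  have closed_coord: "closed {x :: 'a \<Rightarrow> real. x v = 0}" for v
    by (intro closed_Collect_eq continuous_on_product_coordinates continuous_intros)
  have cont_depth: "continuous_on UNIV (depth s)" if "s \<in> T" for s
    unfolding depth_def using that T_finite T_nonempty
    by (intro continuous_on_Min_image continuous_on_product_coordinates) auto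
  have piece_closed: "closedin X (piece j)" if "j \<in> J" for j
  proof (cases j)
    case None
    \<comment> \<open>The cone is closed as the common zero set of the depths.\<close>
    have "piece j = X0 \<inter> (\<Inter>s\<in>T. {x. depth s x = 0})"
      using in_cone_iff by (auto simp: piece_def None X0')
    moreover have "closed (\<Inter>s\<in>T. {x. depth s x = 0})"
      by (intro closed_INT ballI closed_Collect_eq cont_depth continuous_intros)
    ultimately show ?thesis unfolding X0 by (auto simp: closedin_closed)
  next
    case (Some i)
    have "piece j = X0 \<inter> (\<Inter>v\<in>- e i. {x. x v = 0})"
      by (auto simp: piece_def Some X0' face_def)
    moreover have "closed (\<Inter>v\<in>- e i. {x :: 'a \<Rightarrow> real. x v = 0})"
      by (intro closed_INT ballI closed_coord)
    ultimately show ?thesis unfolding X0 by (auto simp: closedin_closed)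
  qed
  have piece_cont: "continuous_map (subtopology X (piece j)) ?W (f j)" if "j \<in> J" for j
  proof (cases j)
    case None
    then have "f j = (\<lambda>_. None)" by (auto simp: f_def)
    then show ?thesis by (simp add: topspace_W)
  next
    case (Some i)
    then have i: "i < n" using that by (auto simp: J_def)
    have sub: "face i \<subseteq> X0" by (auto simp: face_def X0')
    have "continuous_on (face i) (\<phi> i)"
      unfolding \<phi>_def
      by (intro continuous_on_triangle_to_sphere face_sum[OF i])
        (auto intro: continuous_on_subset[OF continuous_on_product_coordinates])
    then have "continuous_map (subtopology X (face i)) euclidean (\<phi> i)"
      using sub by (simp add: X0 subtopology_subtopology Int_absorb1)
    moreover have "\<phi> i ` face i \<subseteq> topspace (nsphere 2)" using \<phi>_in[OF i] by blast
    moreover obtain S0 where S0: "nsphere 2 = top_of_set S0"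
      unfolding nsphere euclidean_product_topology by blast
    moreover have "topspace (subtopology X (face i)) = face i"
      using sub X0' by auto
    ultimately have "continuous_map (subtopology X (face i)) (nsphere 2) (\<phi> i)"
      unfolding S0 by (auto simp: continuous_map_in_subtopology)
    moreover have "continuous_map (nsphere 2) (sum_topology (\<lambda>_. nsphere 2) {..<n}) (Pair i)"
      using i continuous_map_component_injection[of i "{..<n}" "\<lambda>_. nsphere 2"] by simp
    moreover have "continuous_map (sum_topology (\<lambda>_. nsphere 2) {..<n}) ?W ?c"
      unfolding W_def using \<open>n > 0\<close>
      by (intro quotient_imp_continuous_map quotient_map_wedge_collapse nsphere_basepoint) auto
    ultimately have "continuous_map (subtopology X (face i)) ?W (?c \<circ> (Pair i \<circ> \<phi> i))"
      by (intro continuous_map_compose)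
    moreover have "f j = ?c \<circ> (Pair i \<circ> \<phi> i)" "piece j = face i"
      by (auto simp: f_def piece_def Some)
    ultimately show ?thesis by simp
  qed
  \<comment> \<open>Distinct closed triangles meet only in boundary points, which are sent to the
    base point; hence the pieces agree on overlaps.\<close>
  have overlap: "depth (e i) x = 0" if "i < n" "x \<in> face i" "i' < n" "x \<in> face i'" "i \<noteq> i'" for i i' x
  proof (rule ccontr)
    assume "depth (e i) x \<noteq> 0"
    then have "{v. x v \<noteq> 0} = e i"
      using depth_nonzero_iff[OF _ eT[OF that(1)]] that(2) by (auto simp: face_def)
    then have "e i \<subseteq> e i'" using that(4) by (auto simp: face_def)
    moreover have "e i' \<in> K" using eT[OF that(3)] by (simp add: K_def)
    ultimately have "e i' = e i" using T_subset_K[OF eT[OF that(1)]] by blast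
    then show False using e that by (auto simp: bij_betw_def inj_on_def)
  qed
  have outside: "\<exists>i<n. {v. x v \<noteq> 0} = e i" if "x \<in> topspace X" "{v. x v \<noteq> 0} \<notin> cone" for x
    using not_in_cone_iff[OF that(1)] that(2) e by (auto simp: bij_betw_def)
  have cone_depth: "depth (e i) x = 0" if "x \<in> topspace X" "{v. x v \<noteq> 0} \<in> cone" "i < n" for x i
    using in_cone_iff[OF that(1)] that(2) eT[OF that(3)] by blast
  obtain q where q: "continuous_map X ?W q"
    and q_piece: "\<And>x j. \<lbrakk>j \<in> J; x \<in> topspace X \<inter> piece j\<rbrakk> \<Longrightarrow> q x = f j x"
  proof (rule pasting_lemma_exists_closed[of J X piece ?W f])
    show "topspace X \<subseteq> \<Union> (piece ` J)"
    proof
      fix x assume x: "x \<in> topspace X"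
      show "x \<in> \<Union> (piece ` J)"
      proof (cases "{v. x v \<noteq> 0} \<in> cone")
        case True
        then have "x \<in> piece None" using x by (simp add: piece_def)
        then show ?thesis by (auto simp: J_def)
      next
        case False
        then obtain i where "i < n" "{v. x v \<noteq> 0} = e i" using outside x by blast
        then have "x \<in> piece (Some i)" using x face_supp by (simp add: piece_def)
        then show ?thesis using \<open>i < n\<close> by (auto simp: J_def)
      qed
    qed
    show "f j x = f j' x" if "j \<in> J" "j' \<in> J" "x \<in> topspace X \<inter> piece j \<inter> piece j'" for j j' x
    proof -
      have none: "f j x = None" if "j \<in> J" "j' \<in> J" "x \<in> topspace X" "x \<in> piece j" "x \<in> piece j'" "j \<noteq> j'"
        for j j'
      proof (cases j)
        case (Some i)
        then have i: "i < n" "x \<in> face i" using that by (auto simp: J_def piece_def)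
        have "depth (e i) x = 0"
        proof (cases j')
          case None
          then show ?thesis using cone_depth that i by (simp add: piece_def)
        next
          case (Some i')
          then show ?thesis
            using overlap[of i x i'] i that \<open>j = Some i\<close> by (auto simp: J_def piece_def)
        qed
        then show ?thesis using f_None[OF i] Some by simp
      qed (simp add: f_def)
      from none[of j j'] none[of j' j] that show ?thesis by (cases "j = j'") simp_all
    qed
  qed (use piece_closed piece_cont in \<open>auto simp: J_def\<close>)
  have q_cone: "q x = None" if "x \<in> topspace X" "{v. x v \<noteq> 0} \<in> cone" for x
    using q_piece[of None x] that by (simp add: J_def piece_def f_def)
  have q_face: "q x = ?c (i, \<phi> i x)" if "i < n" "x \<in> face i" for i x
    using q_piece[of "Some i" x] that by (simp add: J_def piece_def f_def face_def)
  have q_outside: "\<exists>i<n. x \<in> face i \<and> depth (e i) x > 0 \<and> q x = Some (i, \<phi> i x)"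
    if x: "x \<in> topspace X" "{v. x v \<noteq> 0} \<notin> cone" for x
  proof -
    obtain i where i: "i < n" "{v. x v \<noteq> 0} = e i" using outside x by blast
    then have "x \<in> face i" using face_supp x by simp
    moreover have "depth (e i) x \<noteq> 0" using depth_nonzero_iff[OF x(1) eT[OF i(1)]] i by blast
    moreover have "depth (e i) x \<ge> 0" using depth_nonneg[OF x(1) eT[OF i(1)]] .
    ultimately show ?thesis using q_face[OF i(1)] \<phi>_base[OF i(1)] i(1) by (intro exI[of _ i]) auto
  qed
  define B where "B = {x \<in> topspace X. {v. x v \<noteq> 0} \<in> cone}"
  define apex :: "'a \<Rightarrow> real" where "apex v = (if v = w then 1 else 0)" for v
  have apex: "apex \<in> B"
  proof -
    have "{v. apex v \<noteq> 0} = {w}" by (auto simp: apex_def)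
    moreover have "{w} \<in> cone" using empty_in_A by (auto simp: cone_def)
    moreover from this have "{w} \<in> K" by (simp add: K_def)
    moreover have "0 \<le> apex v" for v by (simp add: apex_def)
    moreover have "sum apex (insert w V) = 1" using V by (simp add: apex_def)
    ultimately show ?thesis by (simp add: B_def topspace_X)
  qed
  have "X homotopy_equivalent_space ?W"
  proof (rule homotopy_equivalent_space_collapse[of X ?W q B flow apex])
    show "compact_space X"
      using V K_subset by (intro compact_space_geometric_realization[of "insert w V"] down_closed_K) auto
    show "q ` topspace X = topspace ?W"
    proof
      show "q ` topspace X \<subseteq> topspace ?W" using q by (rule continuous_map_image_subset_topspace)
      show "topspace ?W \<subseteq> q ` topspace X"
      proof
        fix z assume z: "z \<in> topspace ?W"
        show "z \<in> q ` topspace X"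
        proof (cases z)
          case None
          then show ?thesis using apex q_cone[of apex] by (force simp: B_def)
        next
          case (Some iy)
          then obtain i y where iy: "z = Some (i, y)" "i < n" "y \<in> topspace (nsphere 2)"
              "y \<noteq> nsphere_basepoint"
            using z by (auto simp: topspace_W split: if_splits)
          obtain p r s where prs: "p > 0" "r > 0" "s > 0" "p + r + s = 1" "triangle_to_sphere p r s = y"
            using triangle_to_sphere_surj[OF iy(3,4)] by blast
          define x where "x v = (if v = a i then p else if v = b i then r else if v = c i then s else 0)" for v
          have xa: "x (a i) = p" "x (b i) = r" "x (c i) = s"
            using abc[OF iy(2)] by (auto simp: x_def)
          have supp: "{v. x v \<noteq> 0} = e i"
            using prs unfolding abc(1)[OF iy(2)] by (auto simp: x_def)
          have "sum x (insert w V) = sum x (e i)"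
            using eV[OF iy(2)] V supp by (intro sum.mono_neutral_right) auto
          also have "\<dots> = 1" using abc[OF iy(2)] xa prs by (simp add: add.assoc)
          finally have "sum x (insert w V) = 1" .
          moreover have "e i \<in> K" using eT[OF iy(2)] by (simp add: K_def)
          moreover have "0 \<le> x v" for v using prs by (simp add: x_def)
          ultimately have "x \<in> topspace X" using supp by (simp add: topspace_X)
          moreover from this have "q x = z"
            using q_face[OF iy(2) face_supp] supp iy prs(5) by (simp add: \<phi>_def xa)
          ultimately show ?thesis by blast
        qed
      qed
    qed
    show "q x = q y \<longleftrightarrow> x = y \<or> x \<in> B \<and> y \<in> B" if xy: "x \<in> topspace X" "y \<in> topspace X" for x y
    proof (cases "x \<in> B \<or> y \<in> B")
      case True
      \<comment> \<open>The fibre over the base point is exactly \<open>B\<close>; elsewhere each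
        open triangle is mapped injectively into its own sphere.\<close>
      have "q u = None \<longleftrightarrow> u \<in> B" if "u \<in> topspace X" for u
        using q_cone[of u] q_outside[of u] that
        by (cases "{v. u v \<noteq> 0} \<in> cone") (auto simp: B_def)
      with True xy show ?thesis by metis
    next
      case False
      then obtain i j where i: "i < n" "x \<in> face i" "depth (e i) x > 0" "q x = Some (i, \<phi> i x)"
          and j: "j < n" "y \<in> face j" "depth (e j) y > 0" "q y = Some (j, \<phi> j y)"
        using q_outside[of x] q_outside[of y] xy by (auto simp: B_def)
      have "x = y" if "q x = q y"
      proof -
        have "i = j" "\<phi> i x = \<phi> i y" using that i j by auto
        with i j have "x (a i) = y (a i) \<and> x (b i) = y (b i) \<and> x (c i) = y (c i)"
          unfolding \<phi>_def
          by (intro triangle_to_sphere_inject face_sum) (simp_all add: depth_e)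
        moreover have "x v = 0 \<and> y v = 0" if "v \<notin> e i" for v
          using that i j \<open>i = j\<close> by (simp add: face_def)
        ultimately have "x v = y v" for v
          using abc(1)[OF i(1)] by (cases "v \<in> e i") auto
        then show ?thesis by auto
      qed
      with False show ?thesis by auto
    qed
    show "continuous_map (prod_topology (top_of_set {0..1}) X) X flow"
      using continuous_on_flow flow_in_X unfolding X0
      by (auto simp: continuous_map_in_subtopology X0')
    show "flow (t, x) \<in> B" if "t \<in> {0..1}" "x \<in> B" for t x
      using that flow_in_cone flow_in_X by (simp add: B_def)
    show "flow (1, x) = apex" if "x \<in> B" for x
      using that by (auto simp: B_def flow_cone apex_def)
  qed (use W q flow_0 in \<open>auto simp: B_def\<close>)
  then show ?thesis by (simp add: n_def)
qed

text \<open>The link of the apex \<open>w\<close> in \<open>K\<close> is \<open>A\<close>, so a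
  collapsible \<open>A\<close> allows \<open>w\<close> to be deleted from \<open>K\<close>; what
  remains is \<open>A \<union> T\<close>.\<close>

lemma homotopy_equivalent_wedge_of_spheres:
  assumes "collapsible A"
  shows "geometric_realization (A \<union> T) homotopy_equivalent_space wedge_of_spheres 2 (card T)"
proof -
  have w: "w \<notin> S" if "S \<in> A \<union> T" for S using that V by blast
  have "link K w = A"
  proof (intro equalityI subsetI)
    fix S assume "S \<in> link K w"
    then have S: "w \<notin> S" "insert w S \<in> K" by (auto simp: link_def)
    moreover have "insert w S \<notin> A \<union> T" using w[of "insert w S"] by auto
    ultimately have "insert w S \<in> insert w ` A" by (simp only: K_def cone_def Un_iff) simp
    then obtain S' where S': "insert w S = insert w S'" "S' \<in> A" by (rule imageE)
    then have "w \<notin> S'" using w[of S'] by simp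
    then show "S \<in> A" using S S' by (metis insert_ident)
  next
    fix S assume "S \<in> A"
    then show "S \<in> link K w" using w by (auto simp: link_def K_def cone_def)
  qed
  then have "geometric_realization K homotopy_equivalent_space geometric_realization {S \<in> K. w \<notin> S}"
    using delete_vertex_homotopy_equivalent[OF assms _ _ K_subset down_closed_K] V(1) by simp
  moreover have "{S \<in> K. w \<notin> S} = A \<union> T" using w by (auto simp: K_def cone_def)
  ultimately have "geometric_realization (A \<union> T) homotopy_equivalent_space geometric_realization K"
    by (subst homotopy_equivalent_space_sym) simp
  then show ?thesis
    using K_homotopy_equivalent_wedge_of_spheres by (rule homotopy_eqv_trans)
qed

end

section \<open>The cut complex of the squared path\<close>

lemma arcs_ends_induced_squared_path:
  assumes "S \<subseteq> {1..n}"
  shows "arcs_ends (with_proj (mk_symmetric (with_proj (squared_path n) \<restriction> S))) =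
    {(u, v). u \<in> S \<and> v \<in> S \<and> u \<noteq> v \<and> u \<le> v + 2 \<and> v \<le> u + 2}"
proof -
  have "{u, v} \<in> squared_path_edges n \<longleftrightarrow> u \<noteq> v \<and> u \<le> v + 2 \<and> v \<le> u + 2"
    if "u \<in> {1..n}" "v \<in> {1..n}" for u v
  proof
    assume R: "u \<noteq> v \<and> u \<le> v + 2 \<and> v \<le> u + 2"
    consider "v = u + 1" | "v = u + 2" | "u = v + 1" | "u = v + 2" using R by linarith
    then show "{u, v} \<in> squared_path_edges n"
      using that by cases (fastforce simp: squared_path_edges_def doubleton_eq_iff)+
  qed (auto simp: squared_path_edges_def doubleton_eq_iff)
  note edge = this
  have "parcs (mk_symmetric (with_proj (squared_path n) \<restriction> S)) =
      {(u, v). u \<in> S \<and> v \<in> S \<and> {u, v} \<in> squared_path_edges n}"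
    by (auto simp: mk_symmetric_def induce_subgraph_def squared_path_def insert_commute)
  also have "\<dots> = {(u, v). u \<in> S \<and> v \<in> S \<and> u \<noteq> v \<and> u \<le> v + 2 \<and> v \<le> u + 2}"
    using edge assms by blast
  finally show ?thesis by simp
qed

text \<open>Edges join vertices at distance at most two, so a path cannot jump over two consecutive
  missing vertices. Without such a gap, every vertex of \<open>S\<close> but the last has a larger
  neighbour in \<open>S\<close>, and paths arise by induction on the distance.\<close>

lemma connected_induced_squared_path:
  assumes S: "S \<subseteq> {1..n}" "S \<noteq> {}"
  shows "Digraph_Component.connected (with_proj (squared_path n) \<restriction> S) \<longleftrightarrow>
    \<not> (\<exists>i. i \<notin> S \<and> i + 1 \<notin> S \<and> (\<exists>u\<in>S. u < i) \<and> (\<exists>v\<in>S. i + 1 < v))"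
    (is "_ \<longleftrightarrow> \<not> ?gap")
proof -
  define R where "R = {(u, v). u \<in> S \<and> v \<in> S \<and> u \<noteq> v \<and> u \<le> v + 2 \<and> v \<le> u + 2}"
  have con: "Digraph_Component.connected (with_proj (squared_path n) \<restriction> S) \<longleftrightarrow>
      (\<forall>u\<in>S. \<forall>v\<in>S. (u, v) \<in> rtrancl_on S R)"
    unfolding Digraph_Component.connected_def strongly_connected_def reachable_def R_def
      arcs_ends_induced_squared_path[OF S(1)]
    using S(2) by (simp add: mk_symmetric_def)
  show ?thesis
  proof
    assume c: "Digraph_Component.connected (with_proj (squared_path n) \<restriction> S)"
    show "\<not> ?gap"
    proof
      assume ?gap
      then obtain i u v where i: "i \<notin> S" "i + 1 \<notin> S" "u \<in> S" "u < i" "v \<in> S" "i + 1 < v"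
        by blast
      \<comment> \<open>The induction runs backwards from \<open>v\<close>: everything that reaches
        \<open>v\<close> lies beyond the gap, since an edge leaving that range could only end in
        \<open>i\<close> or \<open>i + 1\<close>.\<close>
      have "i + 1 < x" if "(x, v) \<in> rtrancl_on S R" for x
        using that
      proof induction
        case (step x y)
        then have "i \<le> x" "x \<noteq> i" "x \<noteq> i + 1" using i by (auto simp: R_def)
        then show ?case by linarith
      qed (use i in auto)
      with c i show False unfolding con by fastforce
    qed
  next
    assume gap: "\<not> ?gap"
    have "(u, v) \<in> rtrancl_on S R \<and> (v, u) \<in> rtrancl_on S R"
      if "u \<in> S" "v \<in> S" "u \<le> v" for u v
      using that
    proof (induction "v - u" arbitrary: u rule: less_induct)
      case less
      show ?case
      proof (cases "u = v")
        case False
        have "\<exists>w\<in>S. u < w \<and> w \<le> u + 2 \<and> w \<le> v"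
        proof (rule ccontr)
          assume *: "\<not> ?thesis"
          then have no: "u + 2 < w" if "w \<in> S" "u < w" "w \<le> v" for w
            using that by force
          have "u + 1 + 1 < v" using no[of v] less.prems False by simp
          moreover from this have "u + 1 \<notin> S" "u + 1 + 1 \<notin> S"
            using no[of "u + 1"] no[of "u + 1 + 1"] by auto
          ultimately show False using gap less.prems by (metis less_add_one)
        qed
        then obtain w where w: "w \<in> S" "u < w" "w \<le> u + 2" "w \<le> v" by blast
        then have "(w, v) \<in> rtrancl_on S R \<and> (v, w) \<in> rtrancl_on S R"
          using less by simp
        moreover have "(u, w) \<in> R" "(w, u) \<in> R" using w less.prems by (auto simp: R_def)
        then have "(u, w) \<in> rtrancl_on S R" "(w, u) \<in> rtrancl_on S R"
          using w less.prems by (auto intro: rtrancl_on_into_rtrancl_on rtrancl_on_refl)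
        ultimately show ?thesis by (blast intro: rtrancl_on_trans)
      qed (use less in auto)
    qed
    then show "Digraph_Component.connected (with_proj (squared_path n) \<restriction> S)"
      unfolding con by (meson nat_le_linear)
  qed
qed

text \<open>A triple of consecutive vertices is recorded only by its two smallest elements, so that
  every facet is recorded exactly once.\<close>

definition facet_codes :: "nat \<Rightarrow> (nat \<times> nat) set" where
  "facet_codes n = (SIGMA i:{2..n - 2}. {1..n} - {i - 1, i, i + 1}) - {(n - 2, n)}"

lemma card_3_insert2:
  assumes "card F = 3" "a \<in> F" "b \<in> F" "a \<noteq> b"
  obtains x where "F = {a, b, x}" "x \<noteq> a" "x \<noteq> b"
proof -
  have "card (F - {a, b}) = 1" using assms by (simp add: card_Diff_subset)
  then obtain x where "F - {a, b} = {x}" by (auto simp: card_1_singleton_iff)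
  with assms that[of x] show ?thesis by blast
qed

text \<open>In terms of the deleted triple \<open>F\<close>, the criterion asks for \<open>i\<close>
  and \<open>i + 1\<close> in \<open>F\<close> with survivors on both sides, which leaves one free
  element. The survivors force \<open>2 \<le> i\<close> and \<open>i + 1 < k + 3\<close>.\<close>

lemma cut_facets_squared_path:
  assumes "k \<ge> 3"
  shows "cut_facets k (squared_path (k + 3)) = (\<lambda>(i, j). {i, i + 1, j}) ` facet_codes (k + 3)"
proof -
  let ?n = "k + 3"
  have eq: "cut_facets k (squared_path ?n) = {F. F \<subseteq> {1..?n} \<and> card F = 3 \<and>
      (\<exists>i u v. i \<in> F \<and> i + 1 \<in> F \<and> u \<in> {1..?n} - F \<and> u < i \<and> v \<in> {1..?n} - F \<and> i + 1 < v)}"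
    (is "_ = ?R")
  proof (rule set_eqI)
    fix F
    have "\<not> Digraph_Component.connected (with_proj (squared_path ?n) \<restriction> ({1..?n} - F)) \<longleftrightarrow>
      (\<exists>i u v. i \<in> F \<and> i + 1 \<in> F \<and> u \<in> {1..?n} - F \<and> u < i \<and> v \<in> {1..?n} - F \<and> i + 1 < v)"
      if F: "F \<subseteq> {1..?n}" "card F = 3"
    proof -
      have "card ({1..?n} - F) = k"
        using F by (simp add: card_Diff_subset finite_subset)
      then have "{1..?n} - F \<noteq> {}" using assms by (metis card.empty not_numeral_le_zero)
      moreover have "i \<in> {1..?n}" "i + 1 \<in> {1..?n}"
        if "u \<in> {1..?n} - F" "u < i" "v \<in> {1..?n} - F" "i + 1 < v" for i u v
        using that by auto
      ultimately show ?thesis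
        by (subst connected_induced_squared_path) blast+
    qed
    moreover have "card F + k = card {1..?n} \<longleftrightarrow> card F = 3" by simp
    ultimately show "F \<in> cut_facets k (squared_path ?n) \<longleftrightarrow> F \<in> ?R"
      by (auto simp: cut_facets_def squared_path_def)
  qed
  show ?thesis
  proof (intro equalityI subsetI)
    fix F assume "F \<in> cut_facets k (squared_path ?n)"
    then obtain i u v where F: "F \<subseteq> {1..?n}" "card F = 3" "i \<in> F" "i + 1 \<in> F"
      "u \<in> {1..?n} - F" "u < i" "v \<in> {1..?n} - F" "i + 1 < v"
      unfolding eq by blast
    obtain x where x: "F = {i, i + 1, x}" "x \<noteq> i" "x \<noteq> i + 1"
      using card_3_insert2[of F i "i + 1"] F by auto
    show "F \<in> (\<lambda>(i, j). {i, i + 1, j}) ` facet_codes ?n"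
    proof (cases "x = i - 1")
      case False
      then have "(i, x) \<in> facet_codes ?n" using F x by (auto simp: facet_codes_def)
      then show ?thesis using x by force
    next
      \<comment> \<open>For \<open>F = {i - 1, i, i + 1}\<close> the code is taken at
        \<open>i - 1\<close>; the survivor \<open>u\<close> then lies below \<open>i - 1\<close>,
        whence \<open>2 \<le> i - 1\<close>.\<close>
      case True
      then have "(i - 1, i + 1) \<in> facet_codes ?n" using F x by (auto simp: facet_codes_def)
      moreover have "F = {i - 1, i - 1 + 1, i + 1}" using x F True by auto
      ultimately show ?thesis by (force simp del: diff_Suc_1)
    qed
  next
    fix F assume "F \<in> (\<lambda>(i, j). {i, i + 1, j}) ` facet_codes ?n"
    then obtain i j where ij: "F = {i, i + 1, j}" "(i, j) \<in> facet_codes ?n" by auto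
    have ij': "2 \<le> i" "i + 1 < ?n" "1 \<le> j" "j \<le> ?n" "j \<noteq> i - 1" "j \<noteq> i" "j \<noteq> i + 1"
        "\<not> (i + 2 = ?n \<and> j = ?n)"
      using ij by (auto simp: facet_codes_def)
    \<comment> \<open>The nearest survivor on the right is \<open>i + 2\<close>, or
      \<open>i + 3\<close> if \<open>j = i + 2\<close>; the excluded code guarantees that
      \<open>i + 3\<close> is still a vertex.\<close>
    have "\<exists>v. v \<in> {1..?n} - F \<and> i + 1 < v"
    proof (cases "j = i + 2")
      case True
      then show ?thesis using ij' ij by (intro exI[of _ "i + 3"]) auto
    next
      case False
      then show ?thesis using ij' ij by (intro exI[of _ "i + 2"]) auto
    qed
    moreover have "i - 1 \<in> {1..?n} - F \<and> i - 1 < i" using ij ij' by auto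
    moreover have "F \<subseteq> {1..?n}" "card F = 3" "i \<in> F" "i + 1 \<in> F" using ij ij' by auto
    ultimately show "F \<in> cut_facets k (squared_path ?n)" unfolding eq by blast
  qed
qed

text \<open>\<open>i\<close> can be read off as the smallest element of the triple whose successor
  also belongs to it, thanks to \<open>j \<noteq> i - 1\<close>.\<close>

lemma inj_on_facet_codes: "inj_on (\<lambda>(i, j). {i, i + 1, j}) (facet_codes n)"
proof (rule inj_onI, clarify)
  fix i j i' j' :: nat
  assume *: "(i, j) \<in> facet_codes n" "(i', j') \<in> facet_codes n" "{i, i + 1, j} = {i', i' + 1, j'}"
  have code: "2 \<le> i" "j \<noteq> i - 1" "j \<noteq> i" "j \<noteq> i + 1" "2 \<le> i'" "j' \<noteq> i' - 1" "j' \<noteq> i'" "j' \<noteq> i' + 1"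
    using *(1,2) by (auto simp: facet_codes_def)
  have mem: "i' \<in> {i, i + 1, j}" "i' + 1 \<in> {i, i + 1, j}" "i \<in> {i', i' + 1, j'}"
    "j \<in> {i', i' + 1, j'}"
    using *(3) by blast+
  have "i' \<noteq> i + 1"
  proof
    assume "i' = i + 1"
    with mem(3) code show False by simp
  qed
  moreover have "i' \<noteq> j"
  proof
    assume "i' = j"
    with mem(2) code show False by auto
  qed
  ultimately have "i = i'" using mem(1) by simp
  with mem(4) code show "i = i' \<and> j = j'" by simp
qed

lemma card_facet_codes:
  assumes "n \<ge> 4"
  shows "card (facet_codes n) = (n - 3)\<^sup>2 - 1"
proof -
  have "card ({1..n} - {i - 1, i, i + 1}) = n - 3" if "i \<in> {2..n - 2}" for i
  proof -
    have "i - 1 \<noteq> i" "i - 1 \<noteq> i + 1" using that by auto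
    then have "card {i - 1, i, i + 1} = 3" by simp
    then show ?thesis using that by (subst card_Diff_subset) auto
  qed
  then have "card (SIGMA i:{2..n - 2}. {1..n} - {i - 1, i, i + 1}) = (n - 3)\<^sup>2"
    using assms by (simp add: power2_eq_square)
  moreover have "(n - 2, n) \<in> (SIGMA i:{2..n - 2}. {1..n} - {i - 1, i, i + 1})"
    using assms by auto
  ultimately show ?thesis
    by (simp add: facet_codes_def)
qed

lemma card_facets:
  assumes "k \<ge> 3"
  shows "card (facets (cut_complex k (squared_path (k + 3)))) = k\<^sup>2 - 1"
proof -
  have "finite (pverts (squared_path (k + 3)))" by (simp add: squared_path_def)
  then have "card (facets (cut_complex k (squared_path (k + 3)))) = card (facet_codes (k + 3))"
    using assms by (simp only: facets_cut_complex cut_facets_squared_path card_image[OF inj_on_facet_codes])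
  then show ?thesis using assms by (simp add: card_facet_codes)
qed

text \<open>Compared with \<^const>\<open>facet_codes\<close>, the condition \<open>j \<notin> {i - 1, i, i + 1}\<close> can be
  weakened to \<open>(i, j) \<noteq> (2, 1)\<close> for faces.\<close>

lemma cut_complex_squared_path:
  assumes "k \<ge> 3"
  shows "S \<in> cut_complex k (squared_path (k + 3)) \<longleftrightarrow>
    (\<exists>i j. S \<subseteq> {i, i + 1, j} \<and> 2 \<le> i \<and> i \<le> k + 1 \<and> 1 \<le> j \<and> j \<le> k + 3 \<and>
      \<not> (i = 2 \<and> j = 1) \<and> \<not> (i = k + 1 \<and> j = k + 3))" (is "_ \<longleftrightarrow> ?R")
proof
  assume "S \<in> cut_complex k (squared_path (k + 3))"
  then obtain i j where "S \<subseteq> {i, i + 1, j}" "(i, j) \<in> facet_codes (k + 3)"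
    using assms by (auto simp: cut_complex_def cut_facets_squared_path)
  then show ?R by (intro exI[of _ i] exI[of _ j]) (auto simp: facet_codes_def)
next
  assume ?R
  then obtain i j where S: "S \<subseteq> {i, i + 1, j}" and ij: "2 \<le> i" "i \<le> k + 1" "1 \<le> j" "j \<le> k + 3"
      "\<not> (i = 2 \<and> j = 1)" "\<not> (i = k + 1 \<and> j = k + 3)"
    by blast
  have "\<exists>i j. S \<subseteq> {i, i + 1, j} \<and> (i, j) \<in> facet_codes (k + 3)"
  proof -
    \<comment> \<open>Case 2 records a consecutive triple by its lower pair. In cases 3 and 4 the
      set \<open>{i, i + 1, j}\<close> is only an edge, padded by \<open>1\<close> if
      \<open>i\<close> is large and by \<open>i + 2\<close> if \<open>i\<close> is small;
      \<open>k \<ge> 3\<close> keeps the latter away from the excluded code.\<close>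
    consider "j \<noteq> i - 1" "j \<noteq> i" "j \<noteq> i + 1" | "j = i - 1" | "j = i \<or> j = i + 1" "i \<ge> 4"
      | "j = i \<or> j = i + 1" "i < 4"
      by linarith
    then show ?thesis
    proof cases
      case 1
      then show ?thesis using S ij by (intro exI[of _ i] exI[of _ j]) (auto simp: facet_codes_def)
    next
      case 2
      then show ?thesis
        using S ij by (intro exI[of _ "i - 1"] exI[of _ "i + 1"]) (auto simp: facet_codes_def)
    next
      case 3
      then show ?thesis using S ij assms by (intro exI[of _ i] exI[of _ 1]) (auto simp: facet_codes_def)
    next
      case 4
      then show ?thesis
        using S ij assms by (intro exI[of _ i] exI[of _ "i + 2"]) (auto simp: facet_codes_def)
    qed
  qed
  then show "S \<in> cut_complex k (squared_path (k + 3))"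
    using assms by (auto simp: cut_complex_def cut_facets_squared_path)
qed

section \<open>The spine, the sphere triangles and the inner faces\<close>

lemma collapsible_path:
  fixes a b :: nat
  assumes "a < b"
  shows "collapsible {S. \<exists>i. a \<le> i \<and> i < b \<and> S \<subseteq> {i, i + 1}}" (is "collapsible ?L")
proof (rule collapsible_if_dominated[where a = a and b = b])
  show "?L \<subseteq> Pow {a..b}" by fastforce
  show "insert a S \<in> ?L" if "S \<in> ?L" "S \<subseteq> {a}" for S
    using that assms by (auto intro!: exI[of _ a])
  show "insert j S \<in> ?L" if S: "S \<in> ?L" "Suc j \<in> S" "a \<le> j" "S \<subseteq> {..Suc j}" for S j
  proof -
    obtain i where i: "a \<le> i" "i < b" "S \<subseteq> {i, i + 1}" using S(1) by blast
    have "insert j S \<subseteq> {j, j + 1}"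
    proof
      fix x assume "x \<in> insert j S"
      then have "x = j \<or> x \<le> Suc j \<and> x \<in> {i, i + 1} \<and> Suc j \<in> {i, i + 1}" using i S by blast
      then show "x \<in> {j, j + 1}" by auto
    qed
    moreover have "j < b" using i S(2) by auto
    ultimately show ?thesis using S(3) by blast
  qed
qed

text \<open>Only \<open>S\<close> is bounded, not \<open>a\<close> and \<open>b\<close>, so
  degenerate choices such as \<open>a = b\<close> or \<open>b = N\<close> are allowed; in particular
  every edge on \<open>{2..N}\<close> is included.\<close>

definition spine_faces :: "nat \<Rightarrow> nat set set" where
  "spine_faces N = {S. S \<subseteq> {2..N} \<and> (\<exists>a b. a \<le> b \<and> S \<subseteq> {a, b, b + 1})}"

definition sphere_codes :: "nat \<Rightarrow> (nat \<times> nat) set" where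
  "sphere_codes N = {(a, b). 2 \<le> a \<and> a + 3 \<le> b \<and> b \<le> N}"

definition sphere_faces :: "nat \<Rightarrow> nat set set" where
  "sphere_faces N = (\<lambda>(a, b). {a, a + 1, b}) ` sphere_codes N"

lemma collapsible_spine_faces:
  assumes "N \<ge> 2"
  shows "collapsible (spine_faces N)"
proof (rule collapsible_if_dominated[where a = 2 and b = N])
  show "spine_faces N \<subseteq> Pow {2..N}" by (auto simp: spine_faces_def)
  show "insert 2 S \<in> spine_faces N" if "S \<in> spine_faces N" "S \<subseteq> {2}" for S
  proof -
    have "insert 2 S \<subseteq> {2, 2, 2 + 1}" using that by blast
    moreover have "insert 2 S \<subseteq> {2..N}" using that assms by (auto simp: spine_faces_def)
    ultimately show ?thesis unfolding spine_faces_def by blast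
  qed
  show "insert j S \<in> spine_faces N"
    if S: "S \<in> spine_faces N" "Suc j \<in> S" "2 \<le> j" "S \<subseteq> {..Suc j}" for S j
  proof -
    obtain a b where ab: "a \<le> b" "S \<subseteq> {a, b, b + 1}" "S \<subseteq> {2..N}"
      using S(1) unfolding spine_faces_def by blast
    have x: "x \<le> Suc j \<and> (x = a \<or> x = b \<or> x = b + 1)" if "x \<in> S" for x
      using that ab S by auto
    \<comment> \<open>As \<open>Suc j\<close> is the largest element of \<open>S\<close>, either
      \<open>a \<le> j\<close> and the elements other than \<open>a\<close> are among
      \<open>j\<close>, \<open>j + 1\<close>, or \<open>S\<close> is just
      \<open>{Suc j}\<close>.\<close>
    have "\<exists>a'\<le>j. insert j S \<subseteq> {a', j, j + 1}"
    proof (cases "a \<le> j")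
      case True
      then have "insert j S \<subseteq> {a, j, j + 1}" using x x[OF S(2)] by fastforce
      then show ?thesis using True by blast
    next
      case False
      then have "insert j S \<subseteq> {j, j, j + 1}" using x ab(1) by fastforce
      then show ?thesis by blast
    qed
    moreover have "Suc j \<le> N" using ab(3) S(2) by auto
    then have "insert j S \<subseteq> {2..N}" using ab(3) S(3) by auto
    ultimately show ?thesis unfolding spine_faces_def by blast
  qed
qed

text \<open>Raising the bound by one adds the pairs with \<open>b = Suc N\<close>, of which there
  are \<open>N - 3\<close>; this is Pascal's rule.\<close>

lemma card_sphere_codes: "finite (sphere_codes N) \<and> card (sphere_codes N) = (N - 3) choose 2"
proof (induction N)
  case 0
  have "sphere_codes 0 = {}" by (auto simp: sphere_codes_def)
  then show ?case by simp
next
  case (Suc N)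
  have eq: "sphere_codes (Suc N) = sphere_codes N \<union> (\<lambda>a. (a, Suc N)) ` {2..N - 2}"
    by (auto simp: sphere_codes_def)
  have "card (sphere_codes (Suc N)) = card (sphere_codes N) + card ((\<lambda>a. (a, Suc N)) ` {2..N - 2})"
    unfolding eq using Suc by (intro card_Un_disjoint) (auto simp: sphere_codes_def)
  also have "card ((\<lambda>a. (a, Suc N)) ` {2..N - 2}) = N - 3"
    by (subst card_image) (auto simp: inj_on_def)
  also have "card (sphere_codes N) + (N - 3) = (Suc N - 3) choose 2"
  proof (cases "N < 3")
    case False
    then have "Suc N - 3 = Suc (N - 3)" by simp
    then show ?thesis using Suc by (simp add: numeral_2_eq_2)
  qed (use Suc in simp)
  finally show ?case using Suc unfolding eq by simp
qed

text \<open>Since \<open>a + 3 \<le> b\<close>, a triple contains just one consecutive pair, so its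
  code can be recovered.\<close>

lemma card_sphere_faces: "card (sphere_faces N) = (N - 3) choose 2"
proof -
  have "inj_on (\<lambda>(a, b). {a, a + 1, b}) (sphere_codes N)"
  proof (rule inj_onI, clarify)
    fix a b a' b' :: nat
    assume *: "(a, b) \<in> sphere_codes N" "(a', b') \<in> sphere_codes N" "{a, a + 1, b} = {a', a' + 1, b'}"
    have ab: "a + 3 \<le> b" "a' + 3 \<le> b'" using *(1,2) by (auto simp: sphere_codes_def)
    have "a \<in> {a', a' + 1, b'}" "a' \<in> {a, a + 1, b}" "b \<in> {a', a' + 1, b'}" using *(3) by blast+
    moreover from this have "a = a'" using ab by auto
    ultimately show "a = a' \<and> b = b'" using ab by auto
  qed
  then show ?thesis
    using card_sphere_codes by (simp add: sphere_faces_def card_image)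
qed

text \<open>The vertex \<open>1\<close>, which is absent from the inner faces, serves as the apex.
  The bound on \<open>N\<close> provides the triangle \<open>{2, 3, 5}\<close>.\<close>

lemma coned_triangles_sphere_faces:
  assumes "N \<ge> 5"
  shows "coned_triangles {2..N} 1 (spine_faces N) (sphere_faces N)"
proof
  show "spine_faces N \<subseteq> Pow {2..N}" by (auto simp: spine_faces_def)
  show "sphere_faces N \<subseteq> Pow {2..N}" by (auto simp: sphere_faces_def sphere_codes_def)
  show "down_closed (spine_faces N)"
    unfolding down_closed_def spine_faces_def by (auto, meson order_trans)
  have "(2, 5) \<in> sphere_codes N" using assms by (simp add: sphere_codes_def)
  then show "sphere_faces N \<noteq> {}" by (auto simp: sphere_faces_def)
  show "card s = 3" if "s \<in> sphere_faces N" for s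
    using that by (auto simp: sphere_faces_def sphere_codes_def)
  \<comment> \<open>A spine triangle has a consecutive pair at its top, which
    \<open>a + 3 \<le> b\<close> rules out.\<close>
  show "sphere_faces N \<inter> spine_faces N = {}"
  proof (rule ccontr)
    assume "sphere_faces N \<inter> spine_faces N \<noteq> {}"
    then obtain a b c d :: nat where *: "a + 3 \<le> b" "c \<le> d" "{a, a + 1, b} \<subseteq> {c, d, d + 1}"
      by (auto simp: sphere_faces_def sphere_codes_def spine_faces_def)
    then have "a \<in> {c, d, d + 1}" "a + 1 \<in> {c, d, d + 1}" "b \<in> {c, d, d + 1}" by blast+
    with *(1,2) show False by auto
  qed
  show "s - {u} \<in> spine_faces N" if s: "s \<in> sphere_faces N" "u \<in> s" for s u
  proof -
    obtain a b where ab: "s = {a, a + 1, b}" "2 \<le> a" "a + 3 \<le> b" "b \<le> N"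
      using s(1) by (auto simp: sphere_faces_def sphere_codes_def)
    have "\<exists>c d. c \<le> d \<and> s - {u} \<subseteq> {c, d, d + 1}"
    proof -
      consider "u = a" | "u = a + 1" | "u = b" using s(2) ab(1) by blast
      then show ?thesis
      proof cases
        case 1
        then have "s - {u} \<subseteq> {a + 1, b, b + 1}" using ab(1) by blast
        moreover have "a + 1 \<le> b" using ab by simp
        ultimately show ?thesis by blast
      next
        case 2
        then have "s - {u} \<subseteq> {a, b, b + 1}" using ab(1) by blast
        moreover have "a \<le> b" using ab by simp
        ultimately show ?thesis by blast
      next
        case 3
        then have "s - {u} \<subseteq> {a, a, a + 1}" using ab(1) by blast
        then show ?thesis by blast
      qed
    qed
    moreover have "s - {u} \<subseteq> {2..N}" using ab by auto
    ultimately show ?thesis by (simp add: spine_faces_def)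
  qed
qed auto

lemma cut_complex_inner_faces:
  assumes "k \<ge> 3"
  shows "{S \<in> cut_complex k (squared_path (k + 3)). 1 \<notin> S \<and> k + 3 \<notin> S} =
    spine_faces (k + 2) \<union> sphere_faces (k + 2)" (is "?L = _")
proof (intro equalityI subsetI)
  fix S assume "S \<in> ?L"
  then obtain i j where S: "S \<subseteq> {i, i + 1, j}" "1 \<notin> S" "k + 3 \<notin> S"
    and ij: "2 \<le> i" "i \<le> k + 1" "1 \<le> j" "j \<le> k + 3"
    unfolding cut_complex_squared_path[OF assms] by blast
  have "S \<subseteq> {1..k + 3}" using S(1) ij by auto
  have sub: "S \<subseteq> {2..k + 2}"
  proof
    fix x assume "x \<in> S"
    then have "x \<noteq> 1" "x \<noteq> k + 3" "x \<in> {1..k + 3}" using S \<open>S \<subseteq> {1..k + 3}\<close> by blast+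
    then show "x \<in> {2..k + 2}" by auto
  qed
  have spine: "S \<in> spine_faces (k + 2)" if "a \<le> b" "S \<subseteq> {a, b, b + 1}" for a b
    using that sub unfolding spine_faces_def by blast
  show "S \<in> spine_faces (k + 2) \<union> sphere_faces (k + 2)"
  \<comment> \<open>The only faces outside the spine are full triangles with
    \<open>i + 3 \<le> j\<close>; all others fit into some \<open>{a, b, b + 1}\<close>.\<close>
  proof (cases "j \<in> S \<and> i + 3 \<le> j")
    case False
    consider "j \<notin> S" | "j \<le> i" | "j = i + 1" | "j = i + 2" using False by linarith
    then show ?thesis
    proof cases
      case 1
      then show ?thesis using S(1) spine[of i i] by blast
    next
      case 2
      then show ?thesis using S(1) spine[of j i] by blast
    next
      case 3
      then show ?thesis using S(1) spine[of i i] by blast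
    next
      case 4
      then show ?thesis using S(1) spine[of i "i + 1"] by (simp add: insert_commute)
    qed
  next
    case True
    then have "j \<le> k + 2" using sub by auto
    show ?thesis
    proof (cases "S = {i, i + 1, j}")
      case eq: True
      have "(i, j) \<in> sphere_codes (k + 2)" using True ij \<open>j \<le> k + 2\<close> by (simp add: sphere_codes_def)
      then show ?thesis using eq by (force simp: sphere_faces_def)
    next
      case False
      then have "S \<subseteq> {i, j, j + 1} \<or> S \<subseteq> {i + 1, j, j + 1}" using S(1) True by blast
      then show ?thesis using spine[of i j] spine[of "i + 1" j] True by auto
    qed
  qed
next
  fix S assume S: "S \<in> spine_faces (k + 2) \<union> sphere_faces (k + 2)"
  then have sub: "S \<subseteq> {2..k + 2}"
    by (auto simp: spine_faces_def sphere_faces_def sphere_codes_def)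
  have in_cut: "S \<in> cut_complex k (squared_path (k + 3))"
    if "S \<subseteq> {i, i + 1, j}" "2 \<le> i" "i \<le> k + 1" "2 \<le> j" "j \<le> k + 2" for i j
    unfolding cut_complex_squared_path[OF assms] using that
    by (intro exI[of _ i] exI[of _ j]) auto
  have "S \<in> cut_complex k (squared_path (k + 3))"
  proof (cases "S \<in> sphere_faces (k + 2)")
    case True
    then obtain a b where "S = {a, a + 1, b}" "2 \<le> a" "a + 3 \<le> b" "b \<le> k + 2"
      by (auto simp: sphere_faces_def sphere_codes_def)
    then show ?thesis by (intro in_cut[of a b]) auto
  next
    case False
    then obtain a b where ab: "a \<le> b" "S \<subseteq> {a, b, b + 1}"
      using S by (auto simp: spine_faces_def)
    \<comment> \<open>The spine parameters are unbounded, while \<open>in_cut\<close> needs a pair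
      within \<open>{2..k + 2}\<close> and a third vertex there; clamping loses no vertex of this
      range.\<close>
    define c where "c = min (max b 2) (k + 1)"
    define d where "d = min (max a 2) (k + 2)"
    have "S \<subseteq> {c, c + 1, d}"
    proof
      fix x assume "x \<in> S"
      then have "x \<in> {2..k + 2}" "x \<in> {a, b, b + 1}" using sub ab by blast+
      then show "x \<in> {c, c + 1, d}" using ab(1) by (auto simp: c_def d_def)
    qed
    then show ?thesis by (rule in_cut) (use assms in \<open>auto simp: c_def d_def\<close>)
  qed
  then show "S \<in> ?L" using sub by auto
qed

theorem theorem4p9:
  fixes k :: nat
  assumes "k \<ge> 3"
  shows "geometric_realization (cut_complex k (squared_path (k + 3)))
           homotopy_equivalent_space wedge_of_spheres 2 ((k - 1) choose 2) \<and>
         card (facets (cut_complex k (squared_path (k + 3)))) = k\<^sup>2 - 1"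
proof
  define \<Delta> where "\<Delta> = cut_complex k (squared_path (k + 3))"
  have mem: "S \<in> \<Delta> \<longleftrightarrow> (\<exists>i j. S \<subseteq> {i, i + 1, j} \<and> 2 \<le> i \<and> i \<le> k + 1 \<and> 1 \<le> j \<and> j \<le> k + 3 \<and>
      \<not> (i = 2 \<and> j = 1) \<and> \<not> (i = k + 1 \<and> j = k + 3))" for S
    unfolding \<Delta>_def by (rule cut_complex_squared_path[OF assms])
  have sub: "\<Delta> \<subseteq> Pow {1..k + 3}"
    by (auto simp: \<Delta>_def cut_complex_def cut_facets_def squared_path_def)
  have down: "down_closed {S \<in> \<Delta>. S \<inter> B = {}}" for B
    unfolding down_closed_def \<Delta>_def cut_complex_def by blast
  \<comment> \<open>Since \<open>2 \<le> i\<close>, a face through \<open>1\<close> must have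
    \<open>j = 1\<close>, and excluding the pair \<open>(2, 1)\<close> leaves the path on
    \<open>{3..k + 2}\<close>.\<close>
  have link1: "link \<Delta> 1 = {S. \<exists>i. 3 \<le> i \<and> i < k + 2 \<and> S \<subseteq> {i, i + 1}}"
  proof (intro equalityI subsetI)
    fix S assume "S \<in> link \<Delta> 1"
    then obtain i j where ij: "1 \<notin> S" "insert 1 S \<subseteq> {i, i + 1, j}" "2 \<le> i" "i \<le> k + 1"
        "\<not> (i = 2 \<and> j = 1)"
      by (auto simp: link_def mem)
    then have "j = 1" by auto
    then have "S \<subseteq> {i, i + 1}" "3 \<le> i" "i < k + 2" using ij by auto
    then show "S \<in> {S. \<exists>i. 3 \<le> i \<and> i < k + 2 \<and> S \<subseteq> {i, i + 1}}" by blast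
  next
    fix S assume "S \<in> {S. \<exists>i. 3 \<le> i \<and> i < k + 2 \<and> S \<subseteq> {i, i + 1}}"
    then obtain i where i: "3 \<le> i" "i < k + 2" "S \<subseteq> {i, i + 1}" by blast
    then have "insert 1 S \<in> \<Delta>"
      unfolding mem by (intro exI[of _ i] exI[of _ 1]) auto
    moreover have "1 \<notin> S" using i by auto
    ultimately show "S \<in> link \<Delta> 1" by (simp add: link_def)
  qed
  \<comment> \<open>Since \<open>i + 1 \<le> k + 2\<close>, a face through \<open>k + 3\<close> must
    have \<open>j = k + 3\<close>, and excluding \<open>(k + 1, k + 3)\<close> leaves the path on
    \<open>{2..k + 1}\<close>.\<close>
  have linkn: "link {S \<in> \<Delta>. 1 \<notin> S} (k + 3) = {S. \<exists>i. 2 \<le> i \<and> i < k + 1 \<and> S \<subseteq> {i, i + 1}}"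
  proof (intro equalityI subsetI)
    fix S assume "S \<in> link {S \<in> \<Delta>. 1 \<notin> S} (k + 3)"
    then obtain i j where ij: "k + 3 \<notin> S" "insert (k + 3) S \<subseteq> {i, i + 1, j}" "2 \<le> i" "i \<le> k + 1"
        "\<not> (i = k + 1 \<and> j = k + 3)"
      by (auto simp: link_def mem)
    then have "j = k + 3" by auto
    then have "S \<subseteq> {i, i + 1}" "i < k + 1" using ij by auto
    with ij(3) show "S \<in> {S. \<exists>i. 2 \<le> i \<and> i < k + 1 \<and> S \<subseteq> {i, i + 1}}" by blast
  next
    fix S assume "S \<in> {S. \<exists>i. 2 \<le> i \<and> i < k + 1 \<and> S \<subseteq> {i, i + 1}}"
    then obtain i where i: "2 \<le> i" "i < k + 1" "S \<subseteq> {i, i + 1}" by blast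
    then have "insert (k + 3) S \<in> \<Delta>"
      unfolding mem by (intro exI[of _ i] exI[of _ "k + 3"]) auto
    moreover have "k + 3 \<notin> S" "1 \<notin> insert (k + 3) S" using i by auto
    ultimately show "S \<in> link {S \<in> \<Delta>. 1 \<notin> S} (k + 3)" by (simp add: link_def)
  qed
  have "geometric_realization \<Delta> homotopy_equivalent_space geometric_realization {S \<in> \<Delta>. 1 \<notin> S}"
    using collapsible_path[of 3 "k + 2"] assms sub down[of "{}"]
    by (intro delete_vertex_homotopy_equivalent[OF _ link1[symmetric]]) auto
  also have "geometric_realization {S \<in> \<Delta>. 1 \<notin> S} homotopy_equivalent_space
      geometric_realization {S \<in> {S \<in> \<Delta>. 1 \<notin> S}. k + 3 \<notin> S}"
    using collapsible_path[of 2 "k + 1"] assms sub down[of "{1}"]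
    by (intro delete_vertex_homotopy_equivalent[OF _ linkn[symmetric], of "{1..k + 3}"]) auto
  also have "{S \<in> {S \<in> \<Delta>. 1 \<notin> S}. k + 3 \<notin> S} = spine_faces (k + 2) \<union> sphere_faces (k + 2)"
    unfolding cut_complex_inner_faces[OF assms, symmetric] \<Delta>_def by blast
  also have "geometric_realization \<dots> homotopy_equivalent_space
      wedge_of_spheres 2 (card (sphere_faces (k + 2)))"
    using assms
    by (intro coned_triangles.homotopy_equivalent_wedge_of_spheres[OF coned_triangles_sphere_faces]
        collapsible_spine_faces) simp_all
  also have "card (sphere_faces (k + 2)) = (k - 1) choose 2"
    by (simp add: card_sphere_faces)
  finally show "geometric_realization (cut_complex k (squared_path (k + 3)))
      homotopy_equivalent_space wedge_of_spheres 2 ((k - 1) choose 2)"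
    by (simp add: \<Delta>_def)
  show "card (facets (cut_complex k (squared_path (k + 3)))) = k\<^sup>2 - 1"
    by (rule card_facets[OF assms])
qed

end
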